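(* Let $n\ge 1$ and let $a:\mathbb{T}^n\times\mathbb{R}^n\to\mathbb{C}$ be a continuous bounded function. Suppose that the pseudo-differential operator $$Tf(x)=\int_{\mathbb{R}^n}e^{i2\pi x\cdot\xi}a(x,\xi)(\mathscr{F}_{\mathbb{R}^n}f)(\xi)\,d\xi,\qquad f\in\mathscr{S}(\mathbb{R}^n),$$ extends to a bounded operator on $L^2(\mathbb{R}^n)$. Then the discrete pseudo-differential operator $$t_mf(n')=\int_{\mathbb{T}^n}e^{i2\pi n'\cdot\xi}m(n',\xi)(\mathscr{F}f)(\xi)\,d\xi,\qquad m(n',\xi)=\overline{a(\xi,-n')},\quad f\in\mathscr{S}(\mathbb{Z}^n),\ n'\in\mathbb{Z}^n,$$ extends to a bounded operator on $\ell^2(\mathbb{Z}^n)$. Moreover, some constant $C$ satisfies $\|t_m\|_{\mathscr{B}(\ell^2(\mathbb{Z}^n))}\le C\|T\|_{\mathscr{B}(L^2(\mathbb{R}^n))}$.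
   Context: $\mathbb{T}^n=[0,1]^n$ with opposite faces identified; a function on $\mathbb{T}^n\times\mathbb{R}^n$ is regarded as a function on $\mathbb{R}^n\times\mathbb{R}^n$ that is 1-periodic in each coordinate of the first variable $x$. $\mathscr{F}_{\mathbb{R}^n}f(\xi)=\int_{\mathbb{R}^n}e^{-i2\pi x\cdot\xi}f(x)\,dx$ is the Fourier transform on $\mathbb{R}^n$. $\mathscr{S}(\mathbb{Z}^n)$ is the discrete Schwartz space of rapidly decreasing functions on $\mathbb{Z}^n$, and $\mathscr{F}f(\xi)=\sum_{n'\in\mathbb{Z}^n}e^{-i2\pi n'\cdot\xi}f(n')$. $\|\cdot\|_{\mathscr{B}(X)}$ is the operator norm on $X$. *)

theory Defs
  imports "HOL-Analysis.Analysis"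
begin

section \<open>Square-integrable functions and bounded operators between them\<close>

text \<open>
  Elements of the Hilbert space are represented by functions, with equality almost everywhere in
  place of equality of classes. For \<open>M = lborel\<close> this is \<open>L\<^sup>2(\<real>\<^sup>n)\<close>; for \<open>M = count_space UNIV\<close> on
  \<open>int^'n\<close> it is \<open>\<ell>\<^sup>2(\<int>\<^sup>n)\<close>, where "almost everywhere" means "everywhere".
\<close>

definition L2 :: "'a measure \<Rightarrow> ('a \<Rightarrow> complex) set" where
  "L2 M = {f \<in> borel_measurable M. integrable M (\<lambda>x. (cmod (f x))\<^sup>2)}"

definition norm_L2 :: "'a measure \<Rightarrow> ('a \<Rightarrow> complex) \<Rightarrow> real" where
  "norm_L2 M f = sqrt (\<integral>x. (cmod (f x))\<^sup>2 \<partial>M)"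

text \<open>The values of \<open>U\<close> outside \<open>L2 M\<close> are irrelevant.\<close>

definition bounded_operator_L2 ::
  "'a measure \<Rightarrow> (('a \<Rightarrow> complex) \<Rightarrow> 'a \<Rightarrow> complex) \<Rightarrow> bool" where
  "bounded_operator_L2 M U \<longleftrightarrow>
     (\<forall>f\<in>L2 M. U f \<in> L2 M) \<and>
     (\<forall>f\<in>L2 M. \<forall>g\<in>L2 M. (AE x in M. f x = g x) \<longrightarrow> (AE x in M. U f x = U g x)) \<and>
     (\<forall>f\<in>L2 M. \<forall>g\<in>L2 M. AE x in M. U (\<lambda>y. f y + g y) x = U f x + U g x) \<and>
     (\<forall>c. \<forall>f\<in>L2 M. AE x in M. U (\<lambda>y. c * f y) x = c * U f x) \<and>
     (\<exists>K. \<forall>f\<in>L2 M. norm_L2 M (U f) \<le> K * norm_L2 M f)"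

definition opnorm_L2 :: "'a measure \<Rightarrow> (('a \<Rightarrow> complex) \<Rightarrow> 'a \<Rightarrow> complex) \<Rightarrow> real" where
  "opnorm_L2 M U = (SUP f\<in>{f \<in> L2 M. norm_L2 M f \<le> 1}. norm_L2 M (U f))"

text \<open>\<open>U\<close> is a bounded operator on \<open>L2 M\<close> extending the operator \<open>T\<close>, which is given on \<open>D\<close>.\<close>

definition is_bounded_extension ::
  "'a measure \<Rightarrow> ('a \<Rightarrow> complex) set \<Rightarrow> (('a \<Rightarrow> complex) \<Rightarrow> 'a \<Rightarrow> complex) \<Rightarrow>
   (('a \<Rightarrow> complex) \<Rightarrow> 'a \<Rightarrow> complex) \<Rightarrow> bool" where
  "is_bounded_extension M D T U \<longleftrightarrow>
     bounded_operator_L2 M U \<and> (\<forall>f\<in>D. AE x in M. U f x = T f x)"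

section \<open>Schwartz functions and pseudo-differential operators on Euclidean space\<close>

definition partial_derivative :: "'n \<Rightarrow> (real^'n \<Rightarrow> complex) \<Rightarrow> real^'n \<Rightarrow> complex" where
  "partial_derivative i f x = vector_derivative (\<lambda>t. f (x + t *\<^sub>R axis i 1)) (at 0)"

primrec iterated_partial :: "'n list \<Rightarrow> (real^'n \<Rightarrow> complex) \<Rightarrow> real^'n \<Rightarrow> complex" where
  "iterated_partial [] f = f"
| "iterated_partial (i # is) f = partial_derivative i (iterated_partial is f)"

text \<open>Differentiability of all iterated partial derivatives is smoothness of \<open>f\<close>.\<close>

definition schwartz :: "(real^'n \<Rightarrow> complex) set" where
  "schwartz = {f. \<forall>is. iterated_partial is f differentiable_on UNIV \<and>
      (\<forall>\<alpha> :: 'n \<Rightarrow> nat.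
         bounded (range (\<lambda>x. (\<Prod>j\<in>UNIV. (x $ j) ^ \<alpha> j) *\<^sub>R iterated_partial is f x)))}"

definition fourier :: "(real^'n \<Rightarrow> complex) \<Rightarrow> real^'n \<Rightarrow> complex" where
  "fourier f \<xi> = (\<integral>x. exp (- (\<i> * of_real (2 * pi * (x \<bullet> \<xi>)))) * f x \<partial>lborel)"

definition pseudo_diff_op ::
  "(real^'n \<Rightarrow> real^'n \<Rightarrow> complex) \<Rightarrow> (real^'n \<Rightarrow> complex) \<Rightarrow> real^'n \<Rightarrow> complex" where
  "pseudo_diff_op a f x =
     (\<integral>\<xi>. exp (\<i> * of_real (2 * pi * (x \<bullet> \<xi>))) * a x \<xi> * fourier f \<xi> \<partial>lborel)"

section \<open>Rapidly decreasing sequences and discrete pseudo-differential operators\<close>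

definition vec_of_int :: "int^'n \<Rightarrow> real^'n" where
  "vec_of_int k = (\<chi> j. of_int (k $ j))"

definition discrete_schwartz :: "(int^'n \<Rightarrow> complex) set" where
  "discrete_schwartz =
     {f. \<forall>N::nat. \<exists>C. \<forall>k. (1 + norm (vec_of_int k)) ^ N * cmod (f k) \<le> C}"

definition discrete_fourier :: "(int^'n \<Rightarrow> complex) \<Rightarrow> real^'n \<Rightarrow> complex" where
  "discrete_fourier f \<xi> =
     (\<Sum>\<^sub>\<infinity>k. exp (- (\<i> * of_real (2 * pi * (vec_of_int k \<bullet> \<xi>)))) * f k)"

definition discrete_pseudo_diff_op ::
  "(int^'n \<Rightarrow> real^'n \<Rightarrow> complex) \<Rightarrow> (int^'n \<Rightarrow> complex) \<Rightarrow> int^'n \<Rightarrow> complex" where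
  "discrete_pseudo_diff_op m f k =
     (LINT \<xi>:cbox 0 1|lborel.
        exp (\<i> * of_real (2 * pi * (vec_of_int k \<bullet> \<xi>))) * m k \<xi> * discrete_fourier f \<xi>)"

text \<open>Functions on \<open>\<T>\<^sup>n \<times> \<real>\<^sup>n\<close> are functions on \<open>\<real>\<^sup>n \<times> \<real>\<^sup>n\<close> that are 1-periodic in each
  coordinate of the first variable.\<close>

definition periodic_in_fst :: "(real^'n \<Rightarrow> real^'n \<Rightarrow> complex) \<Rightarrow> bool" where
  "periodic_in_fst a \<longleftrightarrow> (\<forall>x \<xi> j. a (x + axis j 1) \<xi> = a x \<xi>)"

end

theory Submission
  imports Defs "HOL-Probability.Probability"
begin

text \<open>
  The discrete operator is the adjoint of a periodic one, and the periodic one inherits its bound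
  from \<open>\<real>\<^sup>n\<close>. Write \<open>e\<^sub>k\<close> for the character \<open>x \<mapsto> exp (2\<pi>i k\<cdot>x)\<close> and \<open>Q\<close> for the unit cube, and let
  \<open>a(x,D)\<close> act on trigonometric polynomials by \<open>e\<^sub>k \<mapsto> a(\<cdot>,k) e\<^sub>k\<close>. If \<open>f\<close> and \<open>g\<close> have finite support
  and \<open>H = \<Sum> f(l) e\<^sub>-\<^sub>l\<close>, \<open>G = \<Sum> g(k) e\<^sub>-\<^sub>k\<close>, then the pairing of \<open>t\<^sub>m f\<close> with \<open>g\<close> is the integral over
  \<open>Q\<close> of \<open>H\<close> times the conjugate of \<open>a(x,D) G\<close>. Since \<open>H\<close> and \<open>G\<close> have the same square norms as \<open>f\<close> and
  \<open>g\<close>, it suffices to bound \<open>a(x,D)\<close> on \<open>L\<^sup>2(Q)\<close> by a multiple of the norm of \<open>T\<close>.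

  That bound (\<open>torus_transference\<close>) comes from testing \<open>T\<close> on the trigonometric polynomial
  \<open>G = \<Sum> c\<^sub>k e\<^sub>k\<close> damped by a Gaussian of width \<open>M\<close>, which is a Schwartz function. Its Fourier transform
  consists of bumps of width \<open>1/M\<close> at the lattice points \<open>k\<close>, so for large \<open>M\<close> the operator only sees
  the values \<open>a(x,k)\<close>, and \<open>T\<close> maps the damped \<open>G\<close> to the damped \<open>a(x,D) G\<close>, up to an error that is
  controlled by the oscillation of \<open>a(x,\<cdot>)\<close> near the points \<open>k\<close> (\<open>pseudo_diff_op_packet_approx\<close>). The
  error bound is periodic in \<open>x\<close>, bounded, and tends to zero pointwise. On the cube \<open>[0,M]\<^sup>n\<close>, which
  consists of \<open>M\<^sup>n\<close> translates of \<open>Q\<close>, the Gaussian is bounded below by a constant, so the square norm of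
  the image is at least a constant times \<open>M\<^sup>n\<close> times the square norm of \<open>a(x,D) G\<close> on \<open>Q\<close>, up to \<open>o(M\<^sup>n)\<close>.
  The square norm of the damped \<open>G\<close> is asymptotic to a constant times \<open>M\<^sup>n \<Sum> |c\<^sub>k|\<^sup>2\<close>, because damped
  characters with different frequencies become orthogonal (\<open>tendsto_packet_square\<close>). Dividing by \<open>M\<^sup>n\<close>
  gives the claim, with a constant that depends on \<open>n\<close> only.

  On all of \<open>\<ell>\<^sup>2(\<int>\<^sup>n)\<close> the extension of \<open>t\<^sub>m\<close> is given by its matrix with respect to the standard basis;
  a uniform bound on the finite sections of a matrix makes it a bounded operator
  (\<open>matrix_op_bounded\<close>), and absolute summability identifies it with \<open>t\<^sub>m\<close> on rapidly decreasing
  functions (\<open>discrete_pseudo_diff_op_eq_matrix_op\<close>).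
\<close>

section \<open>Waves and Gaussians\<close>

lemma cmod_square_eq_Re: "(cmod z)\<^sup>2 = Re (z * cnj z)"
  by (simp flip: complex_norm_square)

definition wave :: "real^'n \<Rightarrow> real^'n \<Rightarrow> complex" where
  "wave w x = exp (\<i> * of_real (2 * pi * (w \<bullet> x)))"

lemma wave_add_left: "wave (v + w) x = wave v x * wave w x"
  by (simp add: wave_def inner_add_left ring_distribs exp_add)

lemma wave_add_right: "wave w (x + y) = wave w x * wave w y"
  by (simp add: wave_def inner_add_right ring_distribs exp_add)

lemma wave_commute: "wave w x = wave x w"
  by (simp add: wave_def inner_commute)

lemma norm_wave [simp]: "norm (wave w x) = 1"
  by (simp add: wave_def)

lemma cnj_wave: "cnj (wave w x) = wave (- w) x"
  by (simp add: wave_def exp_cnj)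

lemma wave_zero [simp]: "wave 0 x = 1" "wave w 0 = 1"
  by (simp_all add: wave_def)

lemma wave_diff_left: "wave (v - w) x = wave v x * cnj (wave w x)"
  using wave_add_left[of v "- w" x] by (simp add: cnj_wave)

lemma exp_minus_eq_wave: "exp (- (\<i> * of_real (2 * pi * (w \<bullet> x)))) = wave (- w) x"
  by (simp add: wave_def)

lemma continuous_on_wave [continuous_intros]:
  "continuous_on A f \<Longrightarrow> continuous_on A g \<Longrightarrow> continuous_on A (\<lambda>x. wave (f x) (g x))"
  unfolding wave_def by (intro continuous_intros)

lemma measurable_wave [measurable]: "wave w \<in> borel_measurable borel"
  unfolding wave_def by measurable

lemma inner_vec_of_int: "vec_of_int k \<bullet> vec_of_int m = of_int (\<Sum>j\<in>UNIV. k $ j * m $ j)"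
  by (simp add: vec_of_int_def inner_vec_def)

lemma wave_vec_of_int_period [simp]: "wave (vec_of_int k) (vec_of_int m) = 1"
  unfolding wave_def inner_vec_of_int
  using exp_integer_2pi[of "of_int (\<Sum>j\<in>UNIV. k $ j * m $ j)"]
  by (simp add: ac_simps del: of_int_sum)

lemma vec_of_int_minus: "vec_of_int (- k) = - vec_of_int k"
  and vec_of_int_diff: "vec_of_int (k - l) = vec_of_int k - vec_of_int l"
  by (simp_all add: vec_of_int_def vec_eq_iff)

lemma vec_of_int_inject [simp]: "vec_of_int k = vec_of_int l \<longleftrightarrow> k = l"
  by (simp add: vec_of_int_def vec_eq_iff)

lemma vec_of_int_zero [simp]: "vec_of_int 0 = 0"
  by (simp add: vec_of_int_def vec_eq_iff)

definition gaussian :: "real \<Rightarrow> real^'n \<Rightarrow> real" where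
  "gaussian s x = exp (- (pi * s\<^sup>2 * (x \<bullet> x)))"

lemma measurable_gaussian [measurable]: "gaussian s \<in> borel_measurable borel"
  unfolding gaussian_def by measurable

lemma gaussian_nonneg [simp]: "gaussian s x \<ge> 0"
  by (simp add: gaussian_def)

lemma gaussian_scale: "gaussian s (c *\<^sub>R x) = gaussian (s * c) x"
  by (simp add: gaussian_def power2_eq_square)

lemma lborel_integral_affine:
  fixes h :: "'a::euclidean_space \<Rightarrow> 'b::{banach, second_countable_topology}"
  assumes [measurable]: "h \<in> borel_measurable borel" and c: "c \<noteq> 0"
  shows "(\<integral>x. h x \<partial>lborel) = \<bar>c\<bar> ^ DIM('a) *\<^sub>R (\<integral>x. h (t + c *\<^sub>R x) \<partial>lborel)"
  using c by (subst lborel_affine[OF c, of t]) (simp add: integral_density integral_distr)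

lemma lborel_integral_translate:
  fixes h :: "'a::euclidean_space \<Rightarrow> 'b::{banach, second_countable_topology}"
  assumes "h \<in> borel_measurable borel"
  shows "(\<integral>x. h (x + t) \<partial>lborel) = (\<integral>x. h x \<partial>lborel)"
  using lborel_integral_affine[OF assms, of 1 t] by (simp add: add.commute)

lemma lborel_integrable_translate:
  fixes h :: "'a::euclidean_space \<Rightarrow> 'b::{banach, second_countable_topology}"
  assumes "integrable lborel h"
  shows "integrable lborel (\<lambda>x. h (x + t))"
proof -
  have "integrable (distr lborel borel ((+) t)) h" using assms by (simp add: lborel_distr_plus)
  then show ?thesis by (subst (asm) integrable_distr_eq) (use assms in \<open>auto simp: add.commute\<close>)
qed

section \<open>Gaussian integrals\<close>

text \<open>
  Lebesgue measure on \<open>real^'n\<close> is the image of a product measure indexed by \<open>Basis\<close>; the point is to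
  index the factors by the coordinates instead.
\<close>

lemma has_bochner_integral_prod_coordinates:
  fixes g :: "'n::finite \<Rightarrow> real \<Rightarrow> complex"
  assumes g: "\<And>i. has_bochner_integral lborel (g i) (v i)"
  shows "has_bochner_integral (lborel :: (real^'n) measure) (\<lambda>x. \<Prod>i\<in>UNIV. g i (x $ i)) (\<Prod>i\<in>UNIV. v i)"
proof -
  interpret product_sigma_finite "\<lambda>_::real^'n. lborel :: real measure" ..
  define ix :: "real^'n \<Rightarrow> 'n" where "ix b = (THE i. b = axis i 1)" for b
  have ix: "ix (axis i 1) = i" for i
    unfolding ix_def by (auto simp: axis_eq_axis)
  have B: "(Basis :: (real^'n) set) = (\<lambda>i. axis i 1) ` UNIV"
    by (auto simp: Basis_vec_def)
  have inj: "inj_on (\<lambda>i::'n. axis i (1::real)) UNIV"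
    by (auto simp: inj_on_def axis_eq_axis)
  have [measurable]: "g i \<in> borel_measurable borel" for i
    using g[of i] by (auto simp: has_bochner_integral_iff)
  have int: "integrable lborel (g i)" and val: "integral\<^sup>L lborel (g i) = v i" for i
    using g[of i] by (auto simp: has_bochner_integral_iff)
  let ?h = "\<lambda>f::real^'n \<Rightarrow> real. \<Prod>b\<in>Basis. g (ix b) (f b)"
  have coord: "(\<Sum>b\<in>Basis. f b *\<^sub>R b) $ i = f (axis i 1)" for f :: "real^'n \<Rightarrow> real" and i
    unfolding B by (subst sum.reindex[OF inj]) (simp add: axis_def if_distrib cong: if_cong)
  have eq: "(\<Prod>i\<in>UNIV. g i ((\<Sum>b\<in>Basis. f b *\<^sub>R b) $ i)) = ?h f" for f :: "real^'n \<Rightarrow> real"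
    unfolding coord unfolding B by (subst prod.reindex[OF inj]) (simp add: ix)
  have I: "integrable (\<Pi>\<^sub>M b\<in>(Basis::(real^'n) set). lborel) ?h"
    by (rule product_integrable_prod) (auto simp: int)
  have V: "integral\<^sup>L (\<Pi>\<^sub>M b\<in>(Basis::(real^'n) set). lborel) ?h = (\<Prod>i\<in>UNIV. v i)"
    by (subst product_integral_prod)
       (auto simp: int val B prod.reindex[OF inj] ix)
  have m: "(\<lambda>f. \<Sum>b\<in>Basis. f b *\<^sub>R b) \<in> (\<Pi>\<^sub>M b\<in>(Basis::(real^'n) set). lborel) \<rightarrow>\<^sub>M borel"
    by measurable
  have m2: "(\<lambda>x::real^'n. \<Prod>i\<in>UNIV. g i (x $ i)) \<in> borel_measurable borel"
    by measurable
  show ?thesis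
    unfolding has_bochner_integral_iff
    by (subst (1 2) lborel_eq)
       (simp only: integrable_distr_eq[OF m m2] integral_distr[OF m m2] eq I V)
qed

text \<open>
  This is the characteristic function of the standard normal distribution after the substitution
  that turns \<open>exp (- \<pi> s\<^sup>2 x\<^sup>2)\<close> into \<open>exp (- y\<^sup>2 / 2)\<close>.
\<close>

lemma has_bochner_integral_gaussian_1D:
  assumes s: "s > 0"
  shows "has_bochner_integral lborel
           (\<lambda>x. exp (\<i> * of_real (2 * pi * (w * x))) * of_real (exp (- (pi * s\<^sup>2 * x\<^sup>2))))
           (of_real (exp (- (pi * w\<^sup>2 / s\<^sup>2)) / s) :: complex)"
proof -
  define c where "c = sqrt (2 * pi) * s"
  have c: "c > 0" using s by (simp add: c_def)
  have c2: "c\<^sup>2 = 2 * pi * s\<^sup>2" by (simp add: c_def power_mult_distrib)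
  define t where "t = 2 * pi * w / c"
  let ?h = "\<lambda>x. of_real (std_normal_density x) * exp (\<i> * of_real (t * x)) :: complex"
  have nd: "integrable lborel std_normal_density" by simp
  have I: "integrable lborel ?h"
    by (rule Bochner_Integration.integrable_bound[OF nd]) (auto simp: norm_mult normal_density_nonneg)
  have V: "integral\<^sup>L lborel ?h = of_real (exp (- (t\<^sup>2) / 2))"
    using fun_cong[OF char_std_normal_distribution, of t]
    unfolding char_def by (subst (asm) integral_density) (auto simp: scaleR_conv_of_real)
  have "has_bochner_integral lborel ?h (of_real (exp (- (t\<^sup>2) / 2)))"
    using I V by (simp add: has_bochner_integral_iff)
  then have *: "has_bochner_integral lborel (\<lambda>x. ?h (c * x)) (of_real (exp (- (t\<^sup>2) / 2)) /\<^sub>R c)"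
    using c by (subst (asm) lborel_has_bochner_integral_real_affine_iff[of c _ _ 0]) simp_all
  have **: "has_bochner_integral lborel (\<lambda>x. of_real (sqrt (2 * pi)) * ?h (c * x))
     (of_real (sqrt (2 * pi)) * (of_real (exp (- (t\<^sup>2) / 2)) /\<^sub>R c))"
    by (rule has_bochner_integral_mult_right) (rule *)
  have e1: "of_real (sqrt (2 * pi)) * ?h (c * x) =
      exp (\<i> * of_real (2 * pi * (w * x))) * of_real (exp (- (pi * s\<^sup>2 * x\<^sup>2)))" for x
    using c by (simp add: normal_density_def power_mult_distrib c2 t_def field_simps)
  have e2: "of_real (sqrt (2 * pi)) * (of_real (exp (- (t\<^sup>2) / 2)) /\<^sub>R c) =
     (of_real (exp (- (pi * w\<^sup>2 / s\<^sup>2)) / s) :: complex)"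
  proof -
    have "t\<^sup>2 / 2 = pi * w\<^sup>2 / s\<^sup>2"
      using s unfolding t_def power_divide c2 by (simp add: power2_eq_square field_simps)
    then show ?thesis using s by (simp add: scaleR_conv_of_real c_def field_simps)
  qed
  show ?thesis using ** unfolding e1 e2 .
qed

lemma wave_prod: "wave w x = (\<Prod>i\<in>UNIV. exp (\<i> * of_real (2 * pi * (w $ i * x $ i))))"
  unfolding wave_def inner_vec_def by (simp add: sum_distrib_left flip: exp_sum)

text \<open>
  The Fourier transform of a Gaussian. Every integral over \<open>real^'n\<close> that is evaluated below
  reduces to this one.
\<close>

lemma has_bochner_integral_wave_gaussian:
  fixes w :: "real^'n"
  assumes s: "s > 0"
  shows "has_bochner_integral lborel (\<lambda>x. wave w x * of_real (gaussian s x))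
           (of_real (gaussian (1 / s) w / s ^ CARD('n)))"
proof -
  have "gaussian s x = (\<Prod>i\<in>UNIV. exp (- (pi * s\<^sup>2 * (x $ i)\<^sup>2)))" for x :: "real^'n"
    unfolding gaussian_def inner_vec_def
    by (simp add: sum_distrib_left power2_eq_square flip: exp_sum sum_negf)
  moreover have "gaussian (1/s) w / s ^ CARD('n) = (\<Prod>i\<in>UNIV. exp (- (pi * (w $ i)\<^sup>2 / s\<^sup>2)) / s)"
    unfolding gaussian_def inner_vec_def
    by (simp add: prod_dividef sum_distrib_left power2_eq_square sum_divide_distrib flip: exp_sum sum_negf)
  ultimately show ?thesis
    using has_bochner_integral_prod_coordinates[OF has_bochner_integral_gaussian_1D[OF s, of "w $ i" for i]]
    by (simp add: wave_prod prod.distrib)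
qed

lemma integral_gaussian:
  fixes s :: real
  assumes "s > 0"
  shows "integrable lborel (gaussian s :: real^'n \<Rightarrow> real)"
    and "integral\<^sup>L lborel (gaussian s :: real^'n \<Rightarrow> real) = 1 / s ^ CARD('n)"
proof -
  have "has_bochner_integral lborel (\<lambda>x::real^'n. Re (wave 0 x * of_real (gaussian s x)))
          (Re (of_real (gaussian (1 / s) (0 :: real^'n) / s ^ CARD('n))))"
    by (rule has_bochner_integral_Re) (rule has_bochner_integral_wave_gaussian[OF assms])
  then have "has_bochner_integral lborel (gaussian s :: real^'n \<Rightarrow> real) (1 / s ^ CARD('n))"
    by (simp add: gaussian_def[abs_def])
  then show "integrable lborel (gaussian s :: real^'n \<Rightarrow> real)"
    and "integral\<^sup>L lborel (gaussian s :: real^'n \<Rightarrow> real) = 1 / s ^ CARD('n)"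
    by (auto simp: has_bochner_integral_iff)
qed

section \<open>Waves on the unit cube\<close>

lemma measure_unit_cube: "measure lborel (cbox 0 (1 :: real^'n)) = 1"
  using content_cbox_cart[of 0 "1 :: real^'n"] by (simp add: interval_ne_empty_cart)

lemma set_integrable_unit_cube:
  fixes g :: "real^'n \<Rightarrow> 'b::{banach, second_countable_topology}"
  assumes "continuous_on (cbox 0 1) g"
  shows "set_integrable lborel (cbox 0 1) g"
  unfolding set_integrable_def using assms by (intro borel_integrable_compact) auto

lemma set_integral_sum:
  fixes g :: "'i \<Rightarrow> 'a \<Rightarrow> 'b::{banach, second_countable_topology}"
  assumes "\<And>i. i \<in> I \<Longrightarrow> set_integrable M S (g i)"
  shows "(LINT x:S|M. (\<Sum>i\<in>I. g i x)) = (\<Sum>i\<in>I. LINT x:S|M. g i x)"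
  using assms unfolding set_integrable_def set_lebesgue_integral_def
  by (simp add: scaleR_sum_right)

text \<open>
  For \<open>j \<noteq> 0\<close> the antiderivative \<open>exp (2\<pi>i j x) / (2\<pi>i j)\<close> has equal values at the two ends.
\<close>

lemma has_bochner_integral_wave_unit_interval:
  "has_bochner_integral lborel
     (\<lambda>x. indicator {0..1} x *\<^sub>R exp (\<i> * of_real (2 * pi * (of_int j * x))))
     (if j = 0 then 1 else 0 :: complex)"
proof (cases "j = 0")
  case True
  have "has_bochner_integral lborel (\<lambda>x::real. indicator {0..1} x *\<^sub>R (1::complex)) (1 - 0)"
    using has_bochner_integral_FTC_Icc[of 0 1 "of_real :: real \<Rightarrow> complex" "\<lambda>_. 1"]
    by (simp add: bounded_linear.has_vector_derivative[OF bounded_linear_of_real has_vector_derivative_id, simplified])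
  with True show ?thesis by simp
next
  case False
  define F :: "real \<Rightarrow> complex" where
    "F x = exp (\<i> * of_real (2 * pi * (of_int j * x))) / (\<i> * of_real (2 * pi * of_int j))" for x
  have "has_bochner_integral lborel
     (\<lambda>x. indicator {0..1} x *\<^sub>R exp (\<i> * of_real (2 * pi * (of_int j * x)))) (F 1 - F 0)"
  proof (rule has_bochner_integral_FTC_Icc)
    fix x :: real
    show "(F has_vector_derivative exp (\<i> * of_real (2 * pi * (of_int j * x)))) (at x within {0..1})"
    proof -
      define G :: "complex \<Rightarrow> complex" where
        "G z = exp (\<i> * (of_real (2 * pi) * (of_int j * z))) / (\<i> * of_real (2 * pi * of_int j))" for z
      have F: "F = (\<lambda>x. G (of_real x))" by (simp add: F_def G_def fun_eq_iff)
      have "(G has_field_derivative exp (\<i> * of_real (2 * pi * (of_int j * x)))) (at (of_real x))"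
        unfolding G_def using False by (auto intro!: derivative_eq_intros simp: field_simps)
      then show ?thesis unfolding F by (rule has_vector_derivative_real_field)
    qed
  qed (auto intro!: continuous_intros)
  moreover have "F 1 = F 0"
    using exp_integer_2pi[of "of_int j"] by (simp add: F_def ac_simps)
  ultimately show ?thesis using False by simp
qed

lemma indicator_unit_cube:
  "indicator (cbox 0 1) (x :: real^'n) = (\<Prod>i\<in>UNIV. indicator {0..1} (x $ i) :: real)"
  by (auto simp: indicator_def mem_box_cart prod_zero_iff)

lemma integral_wave_unit_cube:
  fixes k :: "int^'n"
  shows "set_integrable lborel (cbox 0 1) (wave (vec_of_int k))"
    and "(LINT x:cbox 0 1|lborel. wave (vec_of_int k) x) = (if k = 0 then 1 else 0)"
proof -
  have "indicator (cbox 0 1) x *\<^sub>R wave (vec_of_int k) x =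
      (\<Prod>i\<in>UNIV. indicator {0..1} (x $ i) *\<^sub>R exp (\<i> * of_real (2 * pi * (of_int (k $ i) * x $ i))))"
    for x
    by (simp add: indicator_unit_cube wave_prod vec_of_int_def scaleR_conv_of_real prod.distrib)
  moreover have "(\<Prod>i\<in>UNIV. if k $ i = 0 then 1 else (0::complex)) = (if k = 0 then 1 else 0)"
    by (auto simp: vec_eq_iff prod_zero_iff)
  ultimately have "has_bochner_integral lborel (\<lambda>x. indicator (cbox 0 1) x *\<^sub>R wave (vec_of_int k) x)
      (if k = 0 then 1 else 0)"
    using has_bochner_integral_prod_coordinates[where g = "\<lambda>i x. indicator {0..1} x *\<^sub>R
          exp (\<i> * of_real (2 * pi * (of_int (k $ i) * x)))" and v = "\<lambda>i. if k $ i = 0 then 1 else 0",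
        OF has_bochner_integral_wave_unit_interval]
    by simp
  then show "set_integrable lborel (cbox 0 1) (wave (vec_of_int k))"
    and "(LINT x:cbox 0 1|lborel. wave (vec_of_int k) x) = (if k = 0 then 1 else 0)"
    by (auto simp: has_bochner_integral_iff set_integrable_def set_lebesgue_integral_def)
qed

text \<open>
  Parseval for trigonometric polynomials: the characters with integer frequencies are orthonormal
  on the cube. The frequencies are negated as in the definition of the discrete Fourier transform.
\<close>

lemma cube_integral_trig_polynomial_square:
  fixes f :: "int^'n \<Rightarrow> complex"
  assumes L: "finite L"
  shows "(LINT \<xi>:cbox 0 1|lborel. (cmod (\<Sum>l\<in>L. wave (- vec_of_int l) \<xi> * f l))\<^sup>2) = (\<Sum>l\<in>L. (cmod (f l))\<^sup>2)"
proof -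
  have hb: "has_bochner_integral lborel (\<lambda>x. indicator (cbox 0 1) x *\<^sub>R wave (vec_of_int k) x) (if k = 0 then 1 else 0)"
    for k :: "int^'n"
    using integral_wave_unit_cube[of k]
    by (simp add: has_bochner_integral_iff set_integrable_def set_lebesgue_integral_def)
  have sq: "indicator (cbox 0 1) \<xi> *\<^sub>R (cmod (\<Sum>l\<in>L. wave (- vec_of_int l) \<xi> * f l))\<^sup>2 =
      Re (\<Sum>l\<in>L. \<Sum>m\<in>L. f l * cnj (f m) * (indicator (cbox 0 1) \<xi> *\<^sub>R wave (vec_of_int (m - l)) \<xi>))" for \<xi>
  proof -
    let ?H = "\<Sum>l\<in>L. wave (- vec_of_int l) \<xi> * f l"
    have "indicator (cbox 0 1) \<xi> *\<^sub>R (cmod ?H)\<^sup>2 = Re (indicator (cbox 0 1) \<xi> *\<^sub>R (?H * cnj ?H))"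
      by (simp only: cmod_square_eq_Re scaleR_complex.sel real_scaleR_def)
    also have "indicator (cbox 0 1) \<xi> *\<^sub>R (?H * cnj ?H) =
      (\<Sum>l\<in>L. \<Sum>m\<in>L. f l * cnj (f m) * (indicator (cbox 0 1) \<xi> *\<^sub>R wave (vec_of_int (m - l)) \<xi>))"
      unfolding cnj_sum sum_product scaleR_sum_right
      by (intro sum.cong refl) (simp add: vec_of_int_diff wave_diff_left cnj_wave ac_simps)
    finally show ?thesis .
  qed
  have "has_bochner_integral lborel
      (\<lambda>\<xi>. Re (\<Sum>l\<in>L. \<Sum>m\<in>L. f l * cnj (f m) * (indicator (cbox 0 1) \<xi> *\<^sub>R wave (vec_of_int (m - l)) \<xi>)))
      (Re (\<Sum>l\<in>L. \<Sum>m\<in>L. f l * cnj (f m) * (if m - l = 0 then 1 else 0)))"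
    by (intro has_bochner_integral_Re has_bochner_integral_sum has_bochner_integral_mult_right hb)
  also have "Re (\<Sum>l\<in>L. \<Sum>m\<in>L. f l * cnj (f m) * (if m - l = 0 then 1 else 0)) = (\<Sum>l\<in>L. (cmod (f l))\<^sup>2)"
    unfolding Re_sum
  proof (intro sum.cong refl)
    fix l assume l: "l \<in> L"
    have "(\<Sum>m\<in>L. Re (f l * cnj (f m) * (if m - l = 0 then 1 else 0))) = (\<Sum>m\<in>L. if m = l then Re (f l * cnj (f m)) else 0)"
      by (intro sum.cong) auto
    also have "\<dots> = Re (f l * cnj (f l))" using l L by simp
    also have "\<dots> = (cmod (f l))\<^sup>2" by (rule cmod_square_eq_Re[symmetric])
    finally show "(\<Sum>m\<in>L. Re (f l * cnj (f m) * (if m - l = 0 then 1 else 0))) = (cmod (f l))\<^sup>2" .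
  qed
  finally show ?thesis
    unfolding set_lebesgue_integral_def sq by (simp only: has_bochner_integral_iff)
qed

section \<open>Gaussian packets are Schwartz functions\<close>

text \<open>
  The linear span of the functions \<open>p(x) exp (2\<pi>i w\<cdot>x) exp (- \<pi> s\<^sup>2 |x|\<^sup>2)\<close> with \<open>p\<close> a monomial. It is generated
  inductively because only closure matters: it is stable under partial derivatives and its members
  decay like a Gaussian, so they are Schwartz functions, and no formula for iterated derivatives is
  needed.
\<close>

inductive_set hermite_packets :: "real \<Rightarrow> (real^'n \<Rightarrow> complex) set" for s where
  wave: "(\<lambda>x. wave w x * of_real (gaussian s x)) \<in> hermite_packets s"
| coordinate: "f \<in> hermite_packets s \<Longrightarrow> (\<lambda>x. of_real (x $ j) * f x) \<in> hermite_packets s"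
| add: "f \<in> hermite_packets s \<Longrightarrow> g \<in> hermite_packets s \<Longrightarrow> (\<lambda>x. f x + g x) \<in> hermite_packets s"
| scale: "f \<in> hermite_packets s \<Longrightarrow> (\<lambda>x. c * f x) \<in> hermite_packets s"

lemma hermite_packets_sum:
  assumes "finite F" "\<And>k. k \<in> F \<Longrightarrow> f k \<in> hermite_packets s"
  shows "(\<lambda>x. \<Sum>k\<in>F. f k x) \<in> hermite_packets s"
  using assms
proof (induction F rule: finite_induct)
  case empty
  show ?case using hermite_packets.scale[OF hermite_packets.wave, where c = 0] by simp
next
  case (insert k F)
  then show ?case by (simp add: hermite_packets.add)
qed

text \<open>
  The total derivative is carried along because the product rule for it gives both
  differentiability and all the partial derivatives at once.
\<close>

lemma hermite_packets_derivative:
  assumes "f \<in> hermite_packets s"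
  shows "\<exists>f'. (\<forall>x. (f has_derivative f' x) (at x)) \<and> (\<forall>i. (\<lambda>x. f' x (axis i 1)) \<in> hermite_packets s)"
  using assms
proof induction
  case (wave w)
  let ?f = "\<lambda>x. wave w x * of_real (gaussian s x)"
  let ?f' = "\<lambda>x h. (\<i> * of_real (2 * pi * (w \<bullet> h))) * ?f x + of_real (- (2 * pi * s\<^sup>2 * (x \<bullet> h))) * ?f x"
  have 1: "(?f has_derivative ?f' x) (at x)" for x
  proof -
    let ?Z = "\<lambda>x. \<i> * of_real (2 * pi * (w \<bullet> x)) + of_real (- (pi * s\<^sup>2 * (x \<bullet> x))) :: complex"
    have eq: "?f = (\<lambda>x. exp (?Z x))"
      by (simp add: wave_def gaussian_def flip: exp_of_real exp_add)
    have "(?Z has_derivative (\<lambda>h. \<i> * of_real (2 * pi * (w \<bullet> h)) + of_real (- (2 * pi * s\<^sup>2 * (x \<bullet> h))))) (at x)"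
      by (auto intro!: derivative_eq_intros simp: algebra_simps inner_commute)
    then have "((\<lambda>x. exp (?Z x)) has_derivative (\<lambda>h. exp (?Z x) *
        (\<i> * of_real (2 * pi * (w \<bullet> h)) + of_real (- (2 * pi * s\<^sup>2 * (x \<bullet> h)))))) (at x)"
      by (rule has_derivative_compose) (rule DERIV_exp[unfolded has_field_derivative_def])
    then show ?thesis unfolding eq[symmetric]
      by (simp add: fun_cong[OF eq] algebra_simps)
  qed
  have 2: "(\<lambda>x. ?f' x (axis i 1)) \<in> hermite_packets s" for i
  proof -
    have "(\<lambda>x. \<i> * of_real (2 * pi * w $ i) * ?f x + of_real (- (2 * pi * s\<^sup>2)) * (of_real (x $ i) * ?f x))
      \<in> hermite_packets s"
      by (intro hermite_packets.intros)
    then show ?thesis by (simp add: inner_axis mult.assoc)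
  qed
  show ?case using 1 2 by (intro exI[of _ ?f']) blast
next
  case (coordinate f j)
  then obtain f' where f': "\<And>x. (f has_derivative f' x) (at x)"
    "\<And>i. (\<lambda>x. f' x (axis i 1)) \<in> hermite_packets s" by blast
  have 1: "((\<lambda>x. of_real (x $ j) * f x) has_derivative (\<lambda>h. of_real (x $ j) * f' x h + of_real (h $ j) * f x)) (at x)" for x
    by (auto intro!: derivative_eq_intros f' bounded_linear.has_derivative[OF bounded_linear_vec_nth])
  have 2: "(\<lambda>x. of_real (x $ j) * f' x (axis i 1) + of_real (axis i 1 $ j) * f x) \<in> hermite_packets s" for i
    by (intro hermite_packets.intros f' coordinate)
  show ?case using 1 2 by (intro exI[of _ "\<lambda>x h. of_real (x $ j) * f' x h + of_real (h $ j) * f x"]) blast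
next
  case (add f g)
  then obtain f' g' where f': "\<And>x. (f has_derivative f' x) (at x)"
    "\<And>i. (\<lambda>x. f' x (axis i 1)) \<in> hermite_packets s" "\<And>x. (g has_derivative g' x) (at x)"
    "\<And>i. (\<lambda>x. g' x (axis i 1)) \<in> hermite_packets s" by blast
  then show ?case
    by (intro exI[of _ "\<lambda>x h. f' x h + g' x h"]) (auto intro!: derivative_intros hermite_packets.add)
next
  case (scale f c)
  then obtain f' where f': "\<And>x. (f has_derivative f' x) (at x)"
    "\<And>i. (\<lambda>x. f' x (axis i 1)) \<in> hermite_packets s" by blast
  then show ?case
    by (intro exI[of _ "\<lambda>x h. c * f' x h"]) (auto intro!: derivative_eq_intros hermite_packets.scale)
qed

lemma hermite_packets_partial_derivative:
  assumes "f \<in> hermite_packets s"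
  shows "partial_derivative i f \<in> hermite_packets s" "f differentiable_on UNIV"
proof -
  obtain f' where f': "\<And>x. (f has_derivative f' x) (at x)"
    "\<And>i. (\<lambda>x. f' x (axis i 1)) \<in> hermite_packets s" using hermite_packets_derivative[OF assms] by blast
  have "partial_derivative i f x = f' x (axis i 1)" for x
  proof -
    have lin: "linear (f' x)" using f'(1) by (rule has_derivative_linear)
    have "((\<lambda>t. f (x + t *\<^sub>R axis i 1)) has_derivative (\<lambda>t. f' x (t *\<^sub>R axis i 1))) (at 0)"
      by (rule has_derivative_compose[where f = "\<lambda>t. x + t *\<^sub>R axis i 1" and g = f])
         (auto intro!: derivative_eq_intros f')
    then show ?thesis unfolding partial_derivative_def
      by (intro vector_derivative_at) (simp add: has_vector_derivative_def linear_scale[OF lin])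
  qed
  then have "partial_derivative i f = (\<lambda>x. f' x (axis i 1))" by auto
  then show "partial_derivative i f \<in> hermite_packets s" using f'(2) by simp
  show "f differentiable_on UNIV"
    using f'(1) by (auto simp: differentiable_on_def differentiable_def)
qed

text \<open>
  A monomial is bounded by a power of \<open>exp (norm x)\<close>. Using such powers rather than powers of \<open>norm x\<close>
  lets the bound survive sums and products without case distinctions, and the Gaussian still
  dominates them.
\<close>

lemma hermite_packets_bound:
  assumes "f \<in> hermite_packets s"
  shows "\<exists>C\<ge>0. \<exists>N::nat. \<forall>x. cmod (f x) \<le> C * exp (norm x) ^ N * gaussian s x"
  using assms
proof induction
  case (wave w)
  show ?case by (intro exI[of _ 1] conjI exI[of _ 0]) (auto simp: norm_mult)
next
  case (coordinate f j)
  then obtain C N where CN: "C \<ge> 0" "\<And>x. cmod (f x) \<le> C * exp (norm x) ^ N * gaussian s x" by blast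
  have "cmod (of_real (x $ j) * f x) \<le> C * exp (norm x) ^ Suc N * gaussian s x" for x
  proof -
    have "\<bar>x $ j\<bar> \<le> exp (norm x)"
      using component_le_norm_cart[of x j] exp_ge_add_one_self[of "norm x"] by linarith
    then have "\<bar>x $ j\<bar> * cmod (f x) \<le> exp (norm x) * (C * exp (norm x) ^ N * gaussian s x)"
      using CN by (intro mult_mono) auto
    then show ?thesis by (simp add: norm_mult ac_simps)
  qed
  then show ?case using CN(1) by blast
next
  case (add f g)
  then obtain C N D M where CN: "C \<ge> 0" "\<And>x. cmod (f x) \<le> C * exp (norm x) ^ N * gaussian s x"
    "D \<ge> 0" "\<And>x. cmod (g x) \<le> D * exp (norm x) ^ M * gaussian s x" by metis
  have "cmod (f x + g x) \<le> (C + D) * exp (norm x) ^ (N + M) * gaussian s x" for x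
  proof -
    have "C * exp (norm x) ^ N * gaussian s x \<le> C * exp (norm x) ^ (N + M) * gaussian s x"
      using CN by (intro mult_mono power_increasing) auto
    moreover have "D * exp (norm x) ^ M * gaussian s x \<le> D * exp (norm x) ^ (N + M) * gaussian s x"
      using CN by (intro mult_mono power_increasing) auto
    ultimately show ?thesis
      using CN(2,4)[of x] norm_triangle_ineq[of "f x" "g x"] by (simp add: algebra_simps)
  qed
  then show ?case using CN(1,3) by (intro exI[of _ "C + D"]) auto
next
  case (scale f c)
  then obtain C N where CN: "C \<ge> 0" "\<And>x. cmod (f x) \<le> C * exp (norm x) ^ N * gaussian s x" by blast
  have "cmod (c * f x) \<le> (cmod c * C) * exp (norm x) ^ N * gaussian s x" for x
    using mult_left_mono[OF CN(2)[of x], of "cmod c"] by (simp add: norm_mult ac_simps)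
  then show ?case using CN(1) by (intro exI[of _ "cmod c * C"]) auto
qed

lemma exp_norm_power_gaussian_le:
  assumes "s > 0"
  shows "exp (norm x) ^ N * gaussian s x \<le> exp ((real N)\<^sup>2 / (4 * pi * s\<^sup>2))"
proof -
  define c where "c = pi * s\<^sup>2"
  have c: "c > 0" using assms by (simp add: c_def)
  have "real N * r - c * r\<^sup>2 \<le> (real N)\<^sup>2 / (4 * c)" for r
  proof -
    \<comment> \<open>Completing the square finds the maximum of \<open>N r - c r\<^sup>2\<close>.\<close>
    have "0 \<le> c * (r - real N / (2 * c))\<^sup>2" using c by simp
    also have "\<dots> = c * r\<^sup>2 - real N * r + (real N)\<^sup>2 / (4 * c)"
      using c by (simp add: power2_eq_square field_simps)
    finally show ?thesis by simp
  qed
  from this[of "norm x"] show ?thesis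
    by (simp add: gaussian_def c_def power2_norm_eq_inner mult.assoc flip: exp_of_nat_mult exp_add)
qed

lemma hermite_packets_subset_schwartz:
  assumes s: "s > 0"
  shows "hermite_packets s \<subseteq> schwartz"
proof
  fix f :: "real^'n \<Rightarrow> complex" assume f: "f \<in> hermite_packets s"
  have it: "iterated_partial is f \<in> hermite_packets s" for "is"
    by (induction "is") (auto simp: f hermite_packets_partial_derivative)
  have "bounded (range (\<lambda>x. (\<Prod>j\<in>UNIV. (x $ j) ^ \<alpha> j) *\<^sub>R g x))"
    if g: "g \<in> hermite_packets s" for g and \<alpha> :: "'n \<Rightarrow> nat"
  proof -
    obtain C N where CN: "C \<ge> 0" "\<And>x. cmod (g x) \<le> C * exp (norm x) ^ N * gaussian s x"
      using hermite_packets_bound[OF g] by blast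
    have "norm ((\<Prod>j\<in>UNIV. (x $ j) ^ \<alpha> j) *\<^sub>R g x)
        \<le> C * exp ((real (sum \<alpha> UNIV + N))\<^sup>2 / (4 * pi * s\<^sup>2))" for x
    proof -
      have c: "\<bar>x $ j\<bar> \<le> exp (norm x)" for j
        using component_le_norm_cart[of x j] exp_ge_add_one_self[of "norm x"] by linarith
      have "\<bar>\<Prod>j\<in>UNIV. (x $ j) ^ \<alpha> j\<bar> = (\<Prod>j\<in>UNIV. \<bar>x $ j\<bar> ^ \<alpha> j)"
        by (simp add: abs_prod power_abs)
      also have "\<dots> \<le> (\<Prod>j\<in>UNIV. exp (norm x) ^ \<alpha> j)"
        by (intro prod_mono conjI power_mono c) auto
      also have "\<dots> = exp (norm x) ^ sum \<alpha> UNIV" by (simp add: power_sum)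
      finally have "\<bar>\<Prod>j\<in>UNIV. (x $ j) ^ \<alpha> j\<bar> * cmod (g x)
          \<le> exp (norm x) ^ sum \<alpha> UNIV * (C * exp (norm x) ^ N * gaussian s x)"
        using CN by (intro mult_mono) auto
      also have "\<dots> = C * (exp (norm x) ^ (sum \<alpha> UNIV + N) * gaussian s x)"
        by (simp add: power_add)
      also have "\<dots> \<le> C * exp ((real (sum \<alpha> UNIV + N))\<^sup>2 / (4 * pi * s\<^sup>2))"
        by (intro mult_left_mono exp_norm_power_gaussian_le s CN)
      finally show ?thesis by simp
    qed
    then show ?thesis by (auto intro!: boundedI)
  qed
  with it hermite_packets_partial_derivative(2)[OF it] show "f \<in> schwartz"
    unfolding schwartz_def by auto
qed

section \<open>Lattice translates of the unit cube\<close>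

text \<open>
  The integrals in question are over the closed cube, but only the open one has disjoint lattice
  translates.
\<close>

lemma AE_unit_cube_eq_box: "AE x in lborel. x \<in> cbox 0 (1::real^'n) \<longleftrightarrow> x \<in> box 0 1"
proof (rule AE_I')
  have "emeasure lborel (cbox 0 (1::real^'n) - box 0 1) = 0"
    by (subst emeasure_Diff) (auto simp: box_subset_cbox emeasure_lborel_cbox_eq emeasure_lborel_box_eq)
  then show "cbox 0 (1::real^'n) - box 0 1 \<in> null_sets lborel" by (auto simp: null_sets_def)
  show "{x \<in> space lborel. \<not> (x \<in> cbox 0 (1::real^'n) \<longleftrightarrow> x \<in> box 0 1)} \<subseteq> cbox 0 1 - box 0 1"
    using box_subset_cbox by auto
qed

text \<open>
  The translates of the open unit cube by lattice points are disjoint, since a point in one of them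
  determines the lattice point as its coordinatewise floor.
\<close>

lemma sum_translated_cube_integrals_le:
  fixes h :: "real^'n \<Rightarrow> real" and N :: "(int^'n) set"
  assumes h: "integrable lborel h" and nn: "\<And>x. h x \<ge> 0" and N: "finite N"
  shows "(\<Sum>m\<in>N. LINT x:cbox 0 1|lborel. h (x + vec_of_int m)) \<le> (\<integral>x. h x \<partial>lborel)"
proof -
  have [measurable]: "h \<in> borel_measurable borel" using h by auto
  let ?I = "\<lambda>m x. indicator (box 0 1) (x - vec_of_int m) * h x"
  have int: "integrable lborel (?I m)" for m
    by (rule Bochner_Integration.integrable_bound[OF h]) (auto split: split_indicator)
  have "(LINT x:cbox 0 1|lborel. h (x + vec_of_int m)) = (\<integral>x. ?I m x \<partial>lborel)" for m
  proof -
    have "(LINT x:cbox 0 1|lborel. h (x + vec_of_int m)) =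
        (\<integral>x. ?I m (x + vec_of_int m) \<partial>lborel)"
      unfolding set_lebesgue_integral_def using AE_unit_cube_eq_box
      by (intro integral_cong_AE) (auto split: split_indicator)
    also have "\<dots> = (\<integral>x. ?I m x \<partial>lborel)"
      by (rule lborel_integral_translate) measurable
    finally show ?thesis .
  qed
  then have "(\<Sum>m\<in>N. LINT x:cbox 0 1|lborel. h (x + vec_of_int m)) = (\<integral>x. (\<Sum>m\<in>N. ?I m x) \<partial>lborel)"
    using int by simp
  also have "\<dots> \<le> (\<integral>x. h x \<partial>lborel)"
  proof (rule integral_mono)
    fix x
    have "(\<Sum>m\<in>N. indicator (box 0 1) (x - vec_of_int m)) \<le> (1::real)"
    proof (cases "\<exists>m\<in>N. x - vec_of_int m \<in> box 0 1")
      case True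
      then obtain m where m: "m \<in> N" "x - vec_of_int m \<in> box 0 1" by blast
      \<comment> \<open>All coordinates of \<open>x - vec_of_int m\<close> lie strictly between 0 and 1.\<close>
      have uniq: "m' = m" if "x - vec_of_int m' \<in> box 0 1" for m'
      proof -
        have "m $ j = \<lfloor>x $ j\<rfloor>" if "x - vec_of_int m \<in> box 0 1" for m :: "int^'n" and j
        proof -
          from that have "0 < x $ j - of_int (m $ j)" "x $ j - of_int (m $ j) < 1"
            by (auto simp: mem_box_cart vec_of_int_def)
          then show ?thesis by linarith
        qed
        then show ?thesis using that m(2) by (simp add: vec_eq_iff)
      qed
      have "indicator (box 0 1) (x - vec_of_int m') = (if m' = m then 1 else (0::real))" for m'
        using uniq[of m'] m(2) by (cases "m' = m") (auto simp: indicator_def)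
      then show ?thesis using N by simp
    next
      case False
      then show ?thesis by (simp add: indicator_def)
    qed
    then show "(\<Sum>m\<in>N. ?I m x) \<le> h x"
      unfolding sum_distrib_right[symmetric] using nn[of x] mult_right_mono[of _ 1 "h x"] by simp
  qed (use int h in auto)
  finally show ?thesis .
qed

lemma card_lattice_cube:
  "finite {m :: int^'n. \<forall>j. 0 \<le> m $ j \<and> m $ j < int M}"
  "card {m :: int^'n. \<forall>j. 0 \<le> m $ j \<and> m $ j < int M} = M ^ CARD('n)"
proof -
  have "bij_betw vec_nth {m :: int^'n. \<forall>j. 0 \<le> m $ j \<and> m $ j < int M} (UNIV \<rightarrow>\<^sub>E {0..<int M})"
    by (rule bij_betwI[where g = vec_lambda]) (auto simp: PiE_iff)
  from bij_betw_finite[OF this] bij_betw_same_card[OF this]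
  show "finite {m :: int^'n. \<forall>j. 0 \<le> m $ j \<and> m $ j < int M}"
  "card {m :: int^'n. \<forall>j. 0 \<le> m $ j \<and> m $ j < int M} = M ^ CARD('n)"
    by (auto simp: card_PiE intro!: finite_PiE)
qed

section \<open>Packets with lattice frequencies\<close>

text \<open>
  A trigonometric polynomial damped by a Gaussian of width \<open>M\<close>. It is not normalised: its square norm
  grows like \<open>M ^ CARD('n)\<close>, which is the number of unit cubes on which the Gaussian is not small.
\<close>

definition packet :: "(int^'n) set \<Rightarrow> (int^'n \<Rightarrow> complex) \<Rightarrow> real \<Rightarrow> real^'n \<Rightarrow> complex" where
  "packet F c M x = (\<Sum>k\<in>F. c k * (wave (vec_of_int k) x * of_real (gaussian (1 / M) x)))"

lemma packet_in_schwartz: "finite F \<Longrightarrow> M > 0 \<Longrightarrow> packet F c M \<in> schwartz"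
  using hermite_packets_subset_schwartz[of "1 / M"]
    hermite_packets_sum[of F "\<lambda>k x. c k * (wave (vec_of_int k) x * of_real (gaussian (1 / M) x))" "1 / M"]
  by (auto simp: packet_def[abs_def] hermite_packets.intros)

lemma measurable_packet [measurable]: "packet F c M \<in> borel_measurable borel"
  unfolding packet_def[abs_def] by measurable

text \<open>
  Multiplying out gives a Gaussian integral against \<open>wave (vec_of_int (k - l))\<close> for each pair of
  frequencies. The product of the two Gaussians is one of width \<open>M / sqrt 2\<close>.
\<close>

lemma has_bochner_integral_packet_square:
  fixes c :: "int^'n \<Rightarrow> complex"
  assumes "finite F" and M: "M > 0"
  shows "has_bochner_integral lborel (\<lambda>x. (cmod (packet F c M x))\<^sup>2)
     (M ^ CARD('n) * (\<Sum>k\<in>F. \<Sum>l\<in>F. Re (c k * cnj (c l)) *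
        (gaussian (M / sqrt 2) (vec_of_int (k - l)) / sqrt 2 ^ CARD('n))))"
proof -
  have g2: "gaussian (1 / M) x * gaussian (1 / M) x = gaussian (sqrt 2 / M) x" for x :: "real^'n"
    by (simp add: gaussian_def power_divide flip: exp_add)
  have "(cmod (packet F c M x))\<^sup>2 =
      Re (\<Sum>k\<in>F. \<Sum>l\<in>F. c k * cnj (c l) * (wave (vec_of_int (k - l)) x * of_real (gaussian (sqrt 2 / M) x)))" for x
  proof -
    have "(cmod (packet F c M x))\<^sup>2 = Re (packet F c M x * cnj (packet F c M x))"
      by (rule cmod_square_eq_Re)
    also have "packet F c M x * cnj (packet F c M x) =
      (\<Sum>k\<in>F. \<Sum>l\<in>F. c k * cnj (c l) * (wave (vec_of_int (k - l)) x * of_real (gaussian (sqrt 2 / M) x)))"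
      unfolding packet_def cnj_sum sum_product
      by (intro sum.cong refl)
         (simp add: vec_of_int_diff wave_diff_left ac_simps flip: g2)
    finally show ?thesis .
  qed
  moreover have "has_bochner_integral lborel (\<lambda>x. Re (\<Sum>k\<in>F. \<Sum>l\<in>F. c k * cnj (c l) *
        (wave (vec_of_int (k - l)) x * of_real (gaussian (sqrt 2 / M) x))))
      (Re (\<Sum>k\<in>F. \<Sum>l\<in>F. c k * cnj (c l) *
        of_real (gaussian (1 / (sqrt 2 / M)) (vec_of_int (k - l)) / (sqrt 2 / M) ^ CARD('n))))"
    using M
    by (intro has_bochner_integral_Re has_bochner_integral_sum has_bochner_integral_mult_right
          has_bochner_integral_wave_gaussian) auto
  moreover have "Re (\<Sum>k\<in>F. \<Sum>l\<in>F. c k * cnj (c l) *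
        of_real (gaussian (1 / (sqrt 2 / M)) (vec_of_int (k - l)) / (sqrt 2 / M) ^ CARD('n)))
     = M ^ CARD('n) * (\<Sum>k\<in>F. \<Sum>l\<in>F. Re (c k * cnj (c l)) *
        (gaussian (M / sqrt 2) (vec_of_int (k - l)) / sqrt 2 ^ CARD('n)))"
    unfolding Re_sum sum_distrib_left
    by (intro sum.cong refl) (simp add: power_divide field_simps)
  ultimately show ?thesis by simp
qed

lemma tendsto_gaussian_lattice:
  "(\<lambda>M. gaussian (real M / sqrt 2) (vec_of_int k)) \<longlonglongrightarrow> (if k = 0 then 1 else 0)"
proof (cases "k = 0")
  case False
  define q where "q = pi / 2 * (vec_of_int k \<bullet> vec_of_int k)"
  have q: "q > 0" using False vec_of_int_inject[of k 0] by (simp add: q_def)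
  have "(\<lambda>M. exp (- (q * (real M)\<^sup>2))) \<longlonglongrightarrow> 0"
    using q by real_asymp
  then show ?thesis using False
    by (simp add: gaussian_def q_def power_divide field_simps)
qed (simp add: gaussian_def)

text \<open>
  Only the diagonal terms survive: the interaction of two different frequencies is a Gaussian of
  width proportional to \<open>1 / M\<close>, evaluated at a nonzero lattice point.
\<close>

lemma tendsto_packet_square:
  fixes c :: "int^'n \<Rightarrow> complex"
  assumes F: "finite F"
  shows "(\<lambda>M. (\<integral>x. (cmod (packet F c (real M) x))\<^sup>2 \<partial>lborel) / real M ^ CARD('n))
           \<longlonglongrightarrow> (\<Sum>k\<in>F. (cmod (c k))\<^sup>2) / sqrt 2 ^ CARD('n)"
proof -
  let ?S = "\<lambda>M. \<Sum>k\<in>F. \<Sum>l\<in>F. Re (c k * cnj (c l)) *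
        (gaussian (real M / sqrt 2) (vec_of_int (k - l)) / sqrt 2 ^ CARD('n))"
  have "?S \<longlonglongrightarrow> (\<Sum>k\<in>F. \<Sum>l\<in>F. Re (c k * cnj (c l)) * ((if k - l = 0 then 1 else 0) / sqrt 2 ^ CARD('n)))"
    by (intro tendsto_intros tendsto_gaussian_lattice) auto
  also have "(\<Sum>k\<in>F. \<Sum>l\<in>F. Re (c k * cnj (c l)) * ((if k - l = 0 then 1 else 0) / sqrt 2 ^ CARD('n))) =
     (\<Sum>k\<in>F. (cmod (c k))\<^sup>2) / sqrt 2 ^ CARD('n)"
    unfolding sum_divide_distrib
  proof (intro sum.cong refl)
    fix k assume k: "k \<in> F"
    have "(\<Sum>l\<in>F. Re (c k * cnj (c l)) * ((if k - l = 0 then 1 else 0) / sqrt 2 ^ CARD('n)))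
       = (\<Sum>l\<in>F. if k = l then Re (c k * cnj (c l)) / sqrt 2 ^ CARD('n) else 0)"
      by (intro sum.cong) auto
    also have "\<dots> = Re (c k * cnj (c k)) / sqrt 2 ^ CARD('n)" using k F by simp
    also have "Re (c k * cnj (c k)) = (cmod (c k))\<^sup>2" by (rule cmod_square_eq_Re[symmetric])
    finally show "(\<Sum>l\<in>F. Re (c k * cnj (c l)) * ((if k - l = 0 then 1 else 0) / sqrt 2 ^ CARD('n))) = (cmod (c k))\<^sup>2 / sqrt 2 ^ CARD('n)" .
  qed
  finally have S: "?S \<longlonglongrightarrow> (\<Sum>k\<in>F. (cmod (c k))\<^sup>2) / sqrt 2 ^ CARD('n)" .
  show ?thesis
  proof (rule Lim_transform_eventually[OF S])
    show "\<forall>\<^sub>F M in sequentially. ?S M = (\<integral>x. (cmod (packet F c (real M) x))\<^sup>2 \<partial>lborel) / real M ^ CARD('n)"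
      using eventually_gt_at_top[of 0]
    proof eventually_elim
      case (elim M)
      then show ?case
        using has_bochner_integral_packet_square[OF F, of "real M" c] by (simp add: has_bochner_integral_iff)
    qed
  qed
qed

text \<open>
  The transform is concentrated near the frequencies of the packet, at scale \<open>1 / M\<close>.
\<close>

lemma fourier_packet:
  fixes c :: "int^'n \<Rightarrow> complex"
  assumes M: "M > 0"
  shows "fourier (packet F c M) \<xi> = (\<Sum>k\<in>F. c k * of_real (M ^ CARD('n) * gaussian M (vec_of_int k - \<xi>)))"
proof -
  have "has_bochner_integral lborel
      (\<lambda>x. \<Sum>k\<in>F. c k * (wave (vec_of_int k - \<xi>) x * of_real (gaussian (1 / M) x)))
      (\<Sum>k\<in>F. c k * of_real (gaussian (1 / (1 / M)) (vec_of_int k - \<xi>) / (1 / M) ^ CARD('n)))"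
    using M by (intro has_bochner_integral_sum has_bochner_integral_mult_right
          has_bochner_integral_wave_gaussian) auto
  moreover have "exp (- (\<i> * of_real (2 * pi * (x \<bullet> \<xi>)))) * packet F c M x =
      (\<Sum>k\<in>F. c k * (wave (vec_of_int k - \<xi>) x * of_real (gaussian (1 / M) x)))" for x
    unfolding packet_def sum_distrib_left inner_commute[of x] exp_minus_eq_wave
    by (intro sum.cong refl)
       (simp add: wave_diff_left cnj_wave ac_simps)
  ultimately show ?thesis
    unfolding fourier_def by (simp add: has_bochner_integral_iff power_divide mult.commute)
qed

section \<open>Transference to the torus\<close>

text \<open>
  Boundedness is stated with an explicit \<open>A\<close>, which serves as a majorant in the convergence
  arguments.
\<close>

locale periodic_symbol =
  fixes a :: "real^'n \<Rightarrow> real^'n \<Rightarrow> complex" and A :: real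
  assumes continuous: "continuous_on UNIV (\<lambda>(x, \<xi>). a x \<xi>)"
    and bound: "cmod (a x \<xi>) \<le> A"
    and periodic: "periodic_in_fst a"
begin

lemma continuous_on_symbol [continuous_intros]:
  assumes "continuous_on S f" "continuous_on S g"
  shows "continuous_on S (\<lambda>x. a (f x) (g x))"
  using continuous_on_compose2[OF continuous continuous_on_Pair[OF assms]] by simp

lemma measurable_symbol [measurable]: "(\<lambda>x. a x \<xi>) \<in> borel_measurable borel" "a x \<in> borel_measurable borel"
  by (intro borel_measurable_continuous_onI continuous_intros)+

lemma bound_nonneg: "A \<ge> 0"
  using bound[of 0 0] norm_ge_zero order_trans by blast

text \<open>
  The periods of a function form a group, and the coordinate vectors generate the lattice.
\<close>

lemma lattice_periodic: "a (x + vec_of_int m) \<xi> = a x \<xi>"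
proof -
  define P where "P = {v. \<forall>x. a (x + v) \<xi> = a x \<xi>}"
  have add: "u + v \<in> P" if "u \<in> P" "v \<in> P" for u v
    using that by (simp add: P_def flip: add.assoc)
  have minus: "- v \<in> P" if v: "v \<in> P" for v
  proof -
    have "a (y + - v) \<xi> = a ((y + - v) + v) \<xi>" for y
      using v[unfolded P_def, THEN CollectD, rule_format, of "y + - v"] by simp
    then show ?thesis by (simp add: P_def)
  qed
  have zero: "0 \<in> P" by (simp add: P_def)
  have ax: "axis j 1 \<in> P" for j
    using periodic by (simp add: P_def periodic_in_fst_def)
  have nat: "of_nat q *\<^sub>R axis j 1 \<in> P" for q :: nat and j
    by (induction q) (auto simp: scaleR_add_left intro: zero add ax)
  have int: "of_int z *\<^sub>R axis j 1 \<in> P" for z j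
  proof (cases z)
    case (nonneg q) then show ?thesis using nat[of q j] by simp
  next
    case (neg q)
    have "real_of_int z = - of_nat (Suc q)" unfolding neg by simp
    then show ?thesis using minus[OF nat[of "Suc q" j]] by (simp only: scaleR_minus_left)
  qed
  have "(\<Sum>j\<in>S. of_int (m $ j) *\<^sub>R axis j 1) \<in> P" if "finite S" for S
    using that by (induction S) (auto intro: zero add int)
  moreover have "vec_of_int m = (\<Sum>j\<in>UNIV. of_int (m $ j) *\<^sub>R axis j 1)"
    by (simp add: vec_of_int_def vec_eq_iff axis_def if_distrib cong: if_cong)
  ultimately show ?thesis by (simp add: P_def)
qed

text \<open>
  The periodic pseudo-differential operator with symbol \<open>a\<close>, applied to the trigonometric polynomial with
  coefficients \<open>c\<close>. It only uses \<open>a(x, \<cdot>)\<close> at lattice points.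
\<close>

definition torus_op :: "(int^'n) set \<Rightarrow> (int^'n \<Rightarrow> complex) \<Rightarrow> real^'n \<Rightarrow> complex" where
  "torus_op F c x = (\<Sum>k\<in>F. c k * wave (vec_of_int k) x * a x (vec_of_int k))"

lemma torus_op_periodic: "torus_op F c (x + vec_of_int m) = torus_op F c x"
  by (simp add: torus_op_def wave_add_right lattice_periodic)

lemma continuous_on_torus_op [continuous_intros]: "continuous_on S (torus_op F c)"
  unfolding torus_op_def[abs_def] by (intro continuous_intros)

lemma measurable_torus_op [measurable]: "torus_op F c \<in> borel_measurable borel"
  by (intro borel_measurable_continuous_onI continuous_intros)

text \<open>
  The error made by replacing \<open>a(x, \<cdot>)\<close> near each frequency by its value there, averaged with the Gaussian
  weight that the transform of a packet of width \<open>M\<close> puts around that frequency. The phases are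
  discarded, so that this bound is periodic in \<open>x\<close>, and one estimate on the unit cube serves for all its
  lattice translates.
\<close>

definition local_oscillation :: "(int^'n) set \<Rightarrow> (int^'n \<Rightarrow> complex) \<Rightarrow> real \<Rightarrow> real^'n \<Rightarrow> real" where
  "local_oscillation F c M x = (\<Sum>k\<in>F. cmod (c k) *
     (\<integral>\<eta>. cmod (a x (vec_of_int k + (1 / M) *\<^sub>R \<eta>) - a x (vec_of_int k)) * gaussian 1 \<eta> \<partial>lborel))"

lemma symbol_diff_bound: "cmod (a x \<xi> - a x \<eta>) \<le> 2 * A"
  using norm_triangle_ineq4[of "a x \<xi>" "a x \<eta>"] bound[of x \<xi>] bound[of x \<eta>] by simp

lemma integrable_oscillation:
  "integrable lborel (\<lambda>\<eta>. cmod (a x (w + c *\<^sub>R \<eta>) - a x w) * gaussian 1 \<eta>)"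
proof (rule Bochner_Integration.integrable_bound)
  show "integrable lborel (\<lambda>\<eta>::real^'n. 2 * A * gaussian 1 \<eta>)"
    by (intro integrable_mult_right integral_gaussian) simp
  show "AE \<eta> in lborel. norm (cmod (a x (w + c *\<^sub>R \<eta>) - a x w) * gaussian 1 \<eta>) \<le> norm (2 * A * gaussian 1 \<eta>)"
    using bound_nonneg by (auto intro!: AE_I2 mult_right_mono symbol_diff_bound simp: abs_mult)
qed measurable

lemma local_oscillation_nonneg: "local_oscillation F c M x \<ge> 0"
  unfolding local_oscillation_def by (intro sum_nonneg mult_nonneg_nonneg integral_nonneg) auto

lemma local_oscillation_le: "local_oscillation F c M x \<le> 2 * A * (\<Sum>k\<in>F. cmod (c k))"
proof -
  have "(\<integral>\<eta>. cmod (a x (w + (1 / M) *\<^sub>R \<eta>) - a x w) * gaussian 1 \<eta> \<partial>lborel)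
      \<le> (\<integral>\<eta>. 2 * A * gaussian 1 (\<eta>::real^'n) \<partial>lborel)" for w
    by (intro integral_mono integrable_oscillation integrable_mult_right integral_gaussian
        mult_right_mono symbol_diff_bound) auto
  also have "(\<integral>\<eta>. 2 * A * gaussian 1 (\<eta>::real^'n) \<partial>lborel) = 2 * A"
    using integral_gaussian[where 'n='n, of 1] by simp
  finally show ?thesis
    unfolding local_oscillation_def sum_distrib_left
    by (intro sum_mono) (simp add: mult.commute[of _ "cmod _"] mult_left_mono)
qed

lemma local_oscillation_periodic:
  "local_oscillation F c M (x + vec_of_int m) = local_oscillation F c M x"
  by (simp add: local_oscillation_def lattice_periodic)

lemma measurable_local_oscillation [measurable]: "local_oscillation F c M \<in> borel_measurable borel"
proof -
  have [measurable]: "(\<lambda>x. \<integral>\<eta>. cmod (a x (w + (1 / M) *\<^sub>R \<eta>) - a x w) * gaussian 1 \<eta> \<partial>lborel) \<in> borel_measurable borel"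
    for w
  proof -
    have "(\<lambda>(x, \<eta>). cmod (a x (w + (1 / M) *\<^sub>R \<eta>) - a x w) * gaussian 1 \<eta>) \<in> borel_measurable borel"
      unfolding gaussian_def case_prod_unfold
      by (intro borel_measurable_continuous_onI continuous_intros)
    then have "(\<lambda>(x, \<eta>). cmod (a x (w + (1 / M) *\<^sub>R \<eta>) - a x w) * gaussian 1 \<eta>) \<in> borel_measurable (borel \<Otimes>\<^sub>M lborel)"
      by (subst measurable_cong_sets[OF sets_pair_measure_cong[OF refl sets_lborel] refl]) (simp only: borel_prod)
    then show ?thesis by (rule lborel.borel_measurable_lebesgue_integral)
  qed
  show ?thesis unfolding local_oscillation_def[abs_def] by measurable
qed

text \<open>
  Dominated convergence in the frequency variable, from continuity of the symbol.
\<close>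

lemma tendsto_local_oscillation:
  "(\<lambda>M. local_oscillation F c (real M) x) \<longlonglongrightarrow> 0"
proof -
  have "(\<lambda>M. \<integral>\<eta>. cmod (a x (w + (1 / real M) *\<^sub>R \<eta>) - a x w) * gaussian 1 \<eta> \<partial>lborel)
      \<longlonglongrightarrow> (\<integral>\<eta>. cmod (a x (w + 0 *\<^sub>R \<eta>) - a x w) * gaussian 1 (\<eta>::real^'n) \<partial>lborel)" for w
  proof (rule integral_dominated_convergence)
    show "integrable lborel (\<lambda>\<eta>::real^'n. 2 * A * gaussian 1 \<eta>)"
      by (intro integrable_mult_right integral_gaussian) simp
    have "continuous_on UNIV (a x)" by (intro continuous_intros)
    then have cont: "isCont (a x) y" for y by (simp add: continuous_on_eq_continuous_at)
    show "AE \<eta> in lborel. (\<lambda>M. cmod (a x (w + (1 / real M) *\<^sub>R \<eta>) - a x w) * gaussian 1 \<eta>)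
        \<longlonglongrightarrow> cmod (a x (w + 0 *\<^sub>R \<eta>) - a x w) * gaussian 1 \<eta>"
      by (intro AE_I2 tendsto_intros isCont_tendsto_compose[OF cont] lim_1_over_n)
    show "AE \<eta> in lborel. norm (cmod (a x (w + (1 / real M) *\<^sub>R \<eta>) - a x w) * gaussian 1 \<eta>) \<le> 2 * A * gaussian 1 \<eta>" for M
      by (auto intro!: AE_I2 mult_right_mono symbol_diff_bound simp: abs_mult)
  qed measurable
  then have "(\<lambda>M. local_oscillation F c (real M) x) \<longlonglongrightarrow> (\<Sum>k\<in>F. cmod (c k) * 0)"
    unfolding local_oscillation_def by (intro tendsto_intros) simp
  then show ?thesis by simp
qed

text \<open>
  Dominated convergence in \<open>x\<close>; the cube has finite measure and the oscillation is bounded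
  uniformly in \<open>M\<close>.
\<close>

lemma tendsto_local_oscillation_L2:
  "(\<lambda>M. LINT x:cbox 0 1|lborel. (local_oscillation F c (real M) x)\<^sup>2) \<longlonglongrightarrow> 0"
proof -
  define D where "D = 2 * A * (\<Sum>k\<in>F. cmod (c k))"
  have "(\<lambda>M. LINT x:cbox 0 1|lborel. (local_oscillation F c (real M) x)\<^sup>2)
      \<longlonglongrightarrow> (\<integral>x. indicator (cbox 0 1) (x::real^'n) *\<^sub>R 0\<^sup>2 \<partial>lborel)"
    unfolding set_lebesgue_integral_def
  proof (rule integral_dominated_convergence)
    show "integrable lborel (\<lambda>x::real^'n. indicator (cbox 0 1) x *\<^sub>R D\<^sup>2)"
      unfolding set_integrable_def[symmetric] by (intro set_integrable_unit_cube continuous_intros)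
    show "AE x in lborel. (\<lambda>M. indicator (cbox 0 1) x *\<^sub>R (local_oscillation F c (real M) x)\<^sup>2)
        \<longlonglongrightarrow> indicator (cbox 0 1) x *\<^sub>R (0::real)\<^sup>2"
      by (intro AE_I2 tendsto_intros tendsto_local_oscillation)
    show "AE x in lborel. norm (indicator (cbox 0 1) x *\<^sub>R (local_oscillation F c (real M) x)\<^sup>2)
        \<le> indicator (cbox 0 1) x *\<^sub>R D\<^sup>2" for M
      unfolding D_def
      by (auto intro!: AE_I2 power_mono local_oscillation_nonneg local_oscillation_le split: split_indicator)
  qed measurable
  then show ?thesis by simp
qed

lemma integrable_wave_symbol:
  "integrable lborel (\<lambda>\<eta>. wave (w + c *\<^sub>R \<eta>) x * a x (w + c *\<^sub>R \<eta>) * of_real (gaussian 1 \<eta>))"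
proof (rule Bochner_Integration.integrable_bound)
  show "integrable lborel (\<lambda>\<eta>::real^'n. A * gaussian 1 \<eta>)"
    by (intro integrable_mult_right integral_gaussian) simp
  show "(\<lambda>\<eta>. wave (w + c *\<^sub>R \<eta>) x * a x (w + c *\<^sub>R \<eta>) * of_real (gaussian 1 \<eta>)) \<in> borel_measurable lborel"
    unfolding wave_commute[of _ x] by measurable
  show "AE \<eta> in lborel. norm (wave (w + c *\<^sub>R \<eta>) x * a x (w + c *\<^sub>R \<eta>) * of_real (gaussian 1 \<eta>)) \<le> norm (A * gaussian 1 \<eta>)"
    using bound_nonneg by (auto intro!: AE_I2 mult_right_mono bound simp: norm_mult)
qed

text \<open>
  The substitution \<open>\<xi> = k + \<eta> / M\<close> around each frequency \<open>k\<close> makes the Gaussian weight independent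
  of \<open>M\<close>.
\<close>

lemma pseudo_diff_op_packet:
  assumes F: "finite F" and M: "M > 0"
  shows "pseudo_diff_op a (packet F c M) x = (\<Sum>k\<in>F. c k *
     (\<integral>\<eta>. wave (vec_of_int k + (1 / M) *\<^sub>R \<eta>) x * a x (vec_of_int k + (1 / M) *\<^sub>R \<eta>) * of_real (gaussian 1 \<eta>) \<partial>lborel))"
proof -
  let ?g = "\<lambda>w \<xi>. wave \<xi> x * a x \<xi> * of_real (M ^ CARD('n) * gaussian M (w - \<xi>))"
  have meas [measurable]: "?g w \<in> borel_measurable borel" for w
    unfolding wave_commute[of _ x] by measurable
  have shift: "gaussian M (w - (w + (1 / M) *\<^sub>R \<eta>)) = gaussian 1 \<eta>" for w \<eta> :: "real^'n"
    using M gaussian_scale[of M "- 1 / M" \<eta>] by (simp add: gaussian_def)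
  have int: "integrable lborel (?g w)" for w
  proof -
    have "integrable lborel (\<lambda>\<xi>::real^'n. A * (M ^ CARD('n) * gaussian M (\<xi> + - w)))"
      by (intro integrable_mult_right lborel_integrable_translate integral_gaussian M)
    then show ?thesis
    proof (rule Bochner_Integration.integrable_bound)
      show "?g w \<in> borel_measurable lborel" 
        by (subst measurable_cong_sets[OF sets_lborel refl]) (rule meas)
      have "gaussian M (w - \<xi>) = gaussian M (\<xi> - w)" for \<xi> :: "real^'n"
        unfolding gaussian_def by (metis inner_minus_left inner_minus_right minus_diff_eq minus_minus)
      then show "AE \<xi> in lborel. norm (?g w \<xi>) \<le> norm (A * (M ^ CARD('n) * gaussian M (\<xi> + - w)))"
        using bound_nonneg M by (auto intro!: AE_I2 mult_right_mono bound simp: norm_mult abs_mult norm_power)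
    qed
  qed
  have eq: "(\<integral>\<xi>. ?g w \<xi> \<partial>lborel) =
      (\<integral>\<eta>. wave (w + (1 / M) *\<^sub>R \<eta>) x * a x (w + (1 / M) *\<^sub>R \<eta>) * of_real (gaussian 1 \<eta>) \<partial>lborel)" for w
  proof -
    have "(\<integral>\<xi>. ?g w \<xi> \<partial>lborel) = \<bar>1 / M\<bar> ^ CARD('n) *\<^sub>R (\<integral>\<eta>. ?g w (w + (1 / M) *\<^sub>R \<eta>) \<partial>lborel)"
      by (rule lborel_integral_affine[OF meas, where t = w and c = "1 / M", unfolded DIM_cart DIM_real mult_1_right])
         (use M in simp)
    also have "\<dots> = (\<integral>\<eta>. \<bar>1 / M\<bar> ^ CARD('n) *\<^sub>R ?g w (w + (1 / M) *\<^sub>R \<eta>) \<partial>lborel)"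
      by simp
    also have "\<dots> = (\<integral>\<eta>. wave (w + (1 / M) *\<^sub>R \<eta>) x * a x (w + (1 / M) *\<^sub>R \<eta>) * of_real (gaussian 1 \<eta>) \<partial>lborel)"
      unfolding shift using M
      by (intro Bochner_Integration.integral_cong refl)
         (simp add: scaleR_conv_of_real power_divide)
    finally show ?thesis .
  qed
  have "pseudo_diff_op a (packet F c M) x = (\<integral>\<xi>. (\<Sum>k\<in>F. c k * ?g (vec_of_int k) \<xi>) \<partial>lborel)"
    unfolding pseudo_diff_op_def fourier_packet[OF M] sum_distrib_left
    by (intro Bochner_Integration.integral_cong refl sum.cong)
       (simp add: wave_def inner_commute ac_simps)
  also have "\<dots> = (\<Sum>k\<in>F. c k * (\<integral>\<xi>. ?g (vec_of_int k) \<xi> \<partial>lborel))"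
    using int by (subst Bochner_Integration.integral_sum) auto
  finally show ?thesis unfolding eq .
qed

text \<open>
  The operator \<open>T\<close> agrees with \<open>pseudo_diff_op a\<close> only almost everywhere, so measurability of the
  latter on packets does not follow from square-integrability of the values of \<open>T\<close>.
\<close>

lemma measurable_pseudo_diff_op_packet:
  assumes F: "finite F" and M: "M > 0"
  shows "pseudo_diff_op a (packet F c M) \<in> borel_measurable borel"
proof -
  have [measurable]: "(\<lambda>x. \<integral>\<eta>. wave (w + (1 / M) *\<^sub>R \<eta>) x * a x (w + (1 / M) *\<^sub>R \<eta>) * of_real (gaussian 1 \<eta>) \<partial>lborel)
     \<in> borel_measurable borel" for w
  proof -
    have "(\<lambda>(x, \<eta>). wave (w + (1 / M) *\<^sub>R \<eta>) x * a x (w + (1 / M) *\<^sub>R \<eta>) * of_real (gaussian 1 \<eta>)) \<in> borel_measurable borel"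
      unfolding gaussian_def case_prod_unfold
      by (intro borel_measurable_continuous_onI continuous_intros)
    then have "(\<lambda>(x, \<eta>). wave (w + (1 / M) *\<^sub>R \<eta>) x * a x (w + (1 / M) *\<^sub>R \<eta>) * of_real (gaussian 1 \<eta>)) \<in> borel_measurable (borel \<Otimes>\<^sub>M lborel)"
      by (subst measurable_cong_sets[OF sets_pair_measure_cong[OF refl sets_lborel] refl]) (simp only: borel_prod)
    then show ?thesis by (rule lborel.borel_measurable_lebesgue_integral)
  qed
  show ?thesis unfolding pseudo_diff_op_packet[OF assms, abs_def] by measurable
qed

text \<open>
  If \<open>a(x, k + \<eta> / M)\<close> is replaced by \<open>a(x, k)\<close>, the integral over \<open>\<eta>\<close> is the Fourier transform of a Gaussian
  at \<open>x / M\<close> and gives back the damping factor of the packet.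
\<close>

lemma pseudo_diff_op_packet_approx:
  assumes F: "finite F" and M: "M > 0"
  shows "cmod (pseudo_diff_op a (packet F c M) x - of_real (gaussian (1 / M) x) * torus_op F c x)
           \<le> local_oscillation F c M x"
proof -
  let ?h = "\<lambda>w \<eta>. wave (w + (1 / M) *\<^sub>R \<eta>) x * a x (w + (1 / M) *\<^sub>R \<eta>) * of_real (gaussian 1 \<eta>)"
  let ?o = "\<lambda>w \<eta>. cmod (a x (w + (1 / M) *\<^sub>R \<eta>) - a x w) * gaussian 1 \<eta>"
  have main: "cmod ((\<integral>\<eta>. ?h w \<eta> \<partial>lborel) - of_real (gaussian (1 / M) x) * (wave w x * a x w)) \<le> (\<integral>\<eta>. ?o w \<eta> \<partial>lborel)" for w
  proof -
    have "has_bochner_integral lborel (\<lambda>\<eta>. wave ((1 / M) *\<^sub>R x) \<eta> * of_real (gaussian 1 \<eta>)) (of_real (gaussian (1/1) ((1 / M) *\<^sub>R x) / 1 ^ CARD('n)))"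
      by (rule has_bochner_integral_wave_gaussian) simp
    then have "has_bochner_integral lborel (\<lambda>\<eta>. wave w x * a x w * (wave ((1 / M) *\<^sub>R x) \<eta> * of_real (gaussian 1 \<eta>)))
        (wave w x * a x w * of_real (gaussian (1/1) ((1 / M) *\<^sub>R x) / 1 ^ CARD('n)))"
      by (rule has_bochner_integral_mult_right)
    moreover have "wave ((1 / M) *\<^sub>R x) \<eta> = wave ((1 / M) *\<^sub>R \<eta>) x" for \<eta>
      by (simp add: wave_def inner_commute)
    ultimately have 1: "has_bochner_integral lborel
       (\<lambda>\<eta>. wave (w + (1 / M) *\<^sub>R \<eta>) x * a x w * of_real (gaussian 1 \<eta>))
        (of_real (gaussian (1 / M) x) * (wave w x * a x w))"
      by (simp add: gaussian_scale wave_add_left ac_simps)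
    have 2: "has_bochner_integral lborel (?h w) (\<integral>\<eta>. ?h w \<eta> \<partial>lborel)"
      by (rule has_bochner_integral_integrable[OF integrable_wave_symbol])
    have "has_bochner_integral lborel (\<lambda>\<eta>. wave (w + (1 / M) *\<^sub>R \<eta>) x * (a x (w + (1 / M) *\<^sub>R \<eta>) - a x w) * of_real (gaussian 1 \<eta>))
       ((\<integral>\<eta>. ?h w \<eta> \<partial>lborel) - of_real (gaussian (1 / M) x) * (wave w x * a x w))"
      using has_bochner_integral_diff[OF 2 1] by (simp add: algebra_simps)
    then have "(\<integral>\<eta>. ?h w \<eta> \<partial>lborel) - of_real (gaussian (1 / M) x) * (wave w x * a x w) =
        (\<integral>\<eta>. wave (w + (1 / M) *\<^sub>R \<eta>) x * (a x (w + (1 / M) *\<^sub>R \<eta>) - a x w) * of_real (gaussian 1 \<eta>) \<partial>lborel)"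
      by (simp add: has_bochner_integral_iff)
    also have "cmod \<dots> \<le> (\<integral>\<eta>. ?o w \<eta> \<partial>lborel)"
      by (rule order_trans[OF integral_norm_bound]) (simp add: norm_mult)
    finally show ?thesis .
  qed
  have "pseudo_diff_op a (packet F c M) x - of_real (gaussian (1 / M) x) * torus_op F c x =
      (\<Sum>k\<in>F. c k * ((\<integral>\<eta>. ?h (vec_of_int k) \<eta> \<partial>lborel) - of_real (gaussian (1 / M) x) * (wave (vec_of_int k) x * a x (vec_of_int k))))"
    unfolding pseudo_diff_op_packet[OF assms] torus_op_def sum_distrib_left sum_subtractf[symmetric]
    by (intro sum.cong refl) (simp add: algebra_simps)
  also have "cmod \<dots> \<le> (\<Sum>k\<in>F. cmod (c k) * (\<integral>\<eta>. ?o (vec_of_int k) \<eta> \<partial>lborel))"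
    by (rule order_trans[OF norm_sum]) (auto intro!: sum_mono mult_left_mono main simp: norm_mult)
  finally show ?thesis unfolding local_oscillation_def .
qed

text \<open>
  On the lattice translates of the unit cube that fill \<open>[0, M]\<^sup>n\<close> the damping factor is at least
  \<open>exp (- \<pi> n)\<close>, so the periodic operator is dominated there by the operator on \<open>real^'n\<close> plus the
  oscillation. Both periodic functions have the same integral over each of the \<open>M ^ CARD('n)\<close> cubes.
\<close>

lemma transference_estimate:
  assumes F: "finite F" and M: "M > 0"
    and int: "integrable lborel (\<lambda>x. (cmod (pseudo_diff_op a (packet F c (real M)) x))\<^sup>2)"
  shows "real M ^ CARD('n) * (exp (- (2 * pi * CARD('n))) * (LINT x:cbox 0 1|lborel. (cmod (torus_op F c x))\<^sup>2)
           - 2 * (LINT x:cbox 0 1|lborel. (local_oscillation F c (real M) x)\<^sup>2))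
         \<le> 2 * (\<integral>x. (cmod (pseudo_diff_op a (packet F c (real M)) x))\<^sup>2 \<partial>lborel)"
proof -
  let ?P = "pseudo_diff_op a (packet F c (real M))"
  let ?G = "torus_op F c"
  let ?d = "local_oscillation F c (real M)"
  define N where "N = {m :: int^'n. \<forall>j. 0 \<le> m $ j \<and> m $ j < int M}"
  have M': "real M > 0" using M by simp
  have [measurable]: "?P \<in> borel_measurable borel" by (rule measurable_pseudo_diff_op_packet[OF F M'])
  have pointwise: "exp (- (2 * pi * CARD('n))) * (cmod (?G x))\<^sup>2 - 2 * (?d x)\<^sup>2 \<le> 2 * (cmod (?P (x + vec_of_int m)))\<^sup>2"
    if m: "m \<in> N" and x: "x \<in> cbox 0 1" for m x
  proof -
    let ?y = "x + vec_of_int m"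
    have "\<bar>?y $ j\<bar> \<le> real M" for j
    proof -
      have "0 \<le> x $ j" "x $ j \<le> 1" using x by (auto simp: mem_box_cart)
      moreover have "0 \<le> m $ j" "m $ j < int M" using m by (auto simp: N_def)
      then have "0 \<le> real_of_int (m $ j)" "real_of_int (m $ j) + 1 \<le> real M" by linarith+
      ultimately show ?thesis by (simp add: vec_of_int_def)
    qed
    then have "(?y $ j)\<^sup>2 \<le> (real M)\<^sup>2" for j by (metis abs_le_square_iff abs_of_nat)
    then have "?y \<bullet> ?y \<le> CARD('n) * (real M)\<^sup>2"
      unfolding inner_vec_def using sum_bounded_above[of UNIV "\<lambda>j. (?y $ j)\<^sup>2" "(real M)\<^sup>2"]
      by (simp add: power2_eq_square)
    then have "pi * (1 / real M)\<^sup>2 * (?y \<bullet> ?y) \<le> pi * CARD('n)"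
      using M' by (simp add: power_divide divide_simps mult.commute)
    then have g: "exp (- (pi * CARD('n))) \<le> gaussian (1 / real M) ?y"
      by (simp add: gaussian_def)
    have "gaussian (1 / real M) ?y * cmod (?G ?y) \<le> cmod (?P ?y) + ?d ?y"
      using pseudo_diff_op_packet_approx[OF F M', of c ?y]
        norm_triangle_ineq2[of "of_real (gaussian (1 / real M) ?y) * ?G ?y" "?P ?y"]
      by (simp add: norm_mult norm_minus_commute)
    moreover have "exp (- (pi * CARD('n))) * cmod (?G ?y) \<le> gaussian (1 / real M) ?y * cmod (?G ?y)"
      by (intro mult_right_mono g) simp
    ultimately have "exp (- (pi * CARD('n))) * cmod (?G x) \<le> cmod (?P ?y) + ?d x"
      by (simp add: torus_op_periodic local_oscillation_periodic)
    then have "(exp (- (pi * CARD('n))) * cmod (?G x))\<^sup>2 \<le> (cmod (?P ?y) + ?d x)\<^sup>2"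
      by (intro power_mono) auto
    also have "\<dots> \<le> 2 * (cmod (?P ?y))\<^sup>2 + 2 * (?d x)\<^sup>2"
      using sum_squares_bound[of "cmod (?P ?y)" "?d x"] by (simp add: power2_sum)
    finally show ?thesis
      by (simp add: power_mult_distrib mult.assoc flip: exp_of_nat_mult)
  qed
  have iG: "set_integrable lborel (cbox 0 1) (\<lambda>x. (cmod (?G x))\<^sup>2)"
    by (intro set_integrable_unit_cube continuous_intros)
  have id: "set_integrable lborel (cbox 0 1) (\<lambda>x. (?d x)\<^sup>2)"
    unfolding set_integrable_def
  proof (rule Bochner_Integration.integrable_bound)
    show "integrable lborel (\<lambda>x::real^'n. indicator (cbox 0 1) x *\<^sub>R (2 * A * (\<Sum>k\<in>F. cmod (c k)))\<^sup>2)"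
      unfolding set_integrable_def[symmetric] by (intro set_integrable_unit_cube continuous_intros)
    show "AE x in lborel. norm (indicator (cbox 0 1) x *\<^sub>R (?d x)\<^sup>2)
        \<le> norm (indicator (cbox 0 1) x *\<^sub>R (2 * A * (\<Sum>k\<in>F. cmod (c k)))\<^sup>2)"
      by (auto intro!: AE_I2 power_mono local_oscillation_nonneg local_oscillation_le split: split_indicator)
  qed measurable
  have cube: "exp (- (2 * pi * CARD('n))) * (LINT x:cbox 0 1|lborel. (cmod (?G x))\<^sup>2)
           - 2 * (LINT x:cbox 0 1|lborel. (?d x)\<^sup>2)
       \<le> (LINT x:cbox 0 1|lborel. 2 * (cmod (?P (x + vec_of_int m)))\<^sup>2)" if m: "m \<in> N" for m
  proof -
    have iP: "set_integrable lborel (cbox 0 1) (\<lambda>x. 2 * (cmod (?P (x + vec_of_int m)))\<^sup>2)"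
      unfolding set_integrable_def
      by (intro integrable_mult_indicator integrable_mult_right
          lborel_integrable_translate[where h = "\<lambda>x. (cmod (?P x))\<^sup>2"] int) simp
    have "exp (- (2 * pi * CARD('n))) * (LINT x:cbox 0 1|lborel. (cmod (?G x))\<^sup>2)
           - 2 * (LINT x:cbox 0 1|lborel. (?d x)\<^sup>2) =
       (LINT x:cbox 0 1|lborel. exp (- (2 * pi * CARD('n))) * (cmod (?G x))\<^sup>2 - 2 * (?d x)\<^sup>2)"
      using iG id by (subst set_integral_diff) auto
    also have "\<dots> \<le> (LINT x:cbox 0 1|lborel. 2 * (cmod (?P (x + vec_of_int m)))\<^sup>2)"
      by (rule set_integral_mono[OF _ iP]) (use iG id pointwise[OF m] in auto)
    finally show ?thesis .
  qed
  have "real M ^ CARD('n) * (exp (- (2 * pi * CARD('n))) * (LINT x:cbox 0 1|lborel. (cmod (?G x))\<^sup>2)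
           - 2 * (LINT x:cbox 0 1|lborel. (?d x)\<^sup>2))
     = (\<Sum>m\<in>N. exp (- (2 * pi * CARD('n))) * (LINT x:cbox 0 1|lborel. (cmod (?G x))\<^sup>2)
           - 2 * (LINT x:cbox 0 1|lborel. (?d x)\<^sup>2))"
    by (simp add: N_def card_lattice_cube)
  also have "\<dots> \<le> (\<Sum>m\<in>N. LINT x:cbox 0 1|lborel. 2 * (cmod (?P (x + vec_of_int m)))\<^sup>2)"
    by (rule sum_mono) (rule cube)
  also have "\<dots> \<le> (\<integral>x. 2 * (cmod (?P x))\<^sup>2 \<partial>lborel)"
    by (rule sum_translated_cube_integrals_le) (use int in \<open>auto simp: N_def card_lattice_cube\<close>)
  finally show ?thesis by simp
qed

text \<open>
  Dividing the previous estimate by \<open>M ^ CARD('n)\<close> and letting \<open>M\<close> tend to infinity. In the constant,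
  \<open>2 * exp (2 * pi * CARD('n))\<close> comes from splitting a square and from the lower bound of the Gaussian on
  the cube, and \<open>sqrt 2 ^ CARD('n)\<close> from the square norm of the packets.
\<close>

theorem torus_transference:
  assumes F: "finite F"
    and int: "\<And>M. M > 0 \<Longrightarrow> integrable lborel (\<lambda>x. (cmod (pseudo_diff_op a (packet F c M) x))\<^sup>2)"
    and B: "\<And>M. M > 0 \<Longrightarrow> (\<integral>x. (cmod (pseudo_diff_op a (packet F c M) x))\<^sup>2 \<partial>lborel)
          \<le> B\<^sup>2 * (\<integral>x. (cmod (packet F c M x))\<^sup>2 \<partial>lborel)"
  shows "(LINT x:cbox 0 1|lborel. (cmod (torus_op F c x))\<^sup>2)
      \<le> 2 * exp (2 * pi * CARD('n)) / sqrt 2 ^ CARD('n) * B\<^sup>2 * (\<Sum>k\<in>F. (cmod (c k))\<^sup>2)"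
proof -
  let ?I = "LINT x:cbox 0 1|lborel. (cmod (torus_op F c x))\<^sup>2"
  let ?e = "exp (- (2 * pi * CARD('n)))"
  have "?e * ?I - 2 * 0 \<le> 2 * B\<^sup>2 * ((\<Sum>k\<in>F. (cmod (c k))\<^sup>2) / sqrt 2 ^ CARD('n))"
  proof (rule tendsto_le[OF sequentially_bot])
    show "(\<lambda>M. ?e * ?I - 2 * (LINT x:cbox 0 1|lborel. (local_oscillation F c (real M) x)\<^sup>2)) \<longlonglongrightarrow> ?e * ?I - 2 * 0"
      by (intro tendsto_intros tendsto_local_oscillation_L2)
    show "(\<lambda>M. 2 * B\<^sup>2 * ((\<integral>x. (cmod (packet F c (real M) x))\<^sup>2 \<partial>lborel) / real M ^ CARD('n)))
        \<longlonglongrightarrow> 2 * B\<^sup>2 * ((\<Sum>k\<in>F. (cmod (c k))\<^sup>2) / sqrt 2 ^ CARD('n))"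
      by (intro tendsto_intros tendsto_packet_square F)
    show "\<forall>\<^sub>F M in sequentially. ?e * ?I - 2 * (LINT x:cbox 0 1|lborel. (local_oscillation F c (real M) x)\<^sup>2)
       \<le> 2 * B\<^sup>2 * ((\<integral>x. (cmod (packet F c (real M) x))\<^sup>2 \<partial>lborel) / real M ^ CARD('n))"
      using eventually_gt_at_top[of 0]
    proof eventually_elim
      case (elim M)
      have "real M ^ CARD('n) * (?e * ?I - 2 * (LINT x:cbox 0 1|lborel. (local_oscillation F c (real M) x)\<^sup>2))
          \<le> 2 * (B\<^sup>2 * (\<integral>x. (cmod (packet F c (real M) x))\<^sup>2 \<partial>lborel))"
        using transference_estimate[OF F elim, of c] int[of "real M"] B[of "real M"] elim by simp
      then show ?case using elim by (simp add: field_simps)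
    qed
  qed
  then have "exp (2 * pi * CARD('n)) * (?e * ?I) \<le> exp (2 * pi * CARD('n)) * (2 * B\<^sup>2 * ((\<Sum>k\<in>F. (cmod (c k))\<^sup>2) / sqrt 2 ^ CARD('n)))"
    by (intro mult_left_mono) auto
  then show ?thesis
    by (simp add: exp_minus field_simps)
qed

end

section \<open>Operator norms on square-integrable functions\<close>

lemma norm_L2_nonneg: "norm_L2 M f \<ge> 0"
  by (simp add: norm_L2_def)

lemma norm_L2_square: "(norm_L2 M f)\<^sup>2 = (\<integral>x. (cmod (f x))\<^sup>2 \<partial>M)"
  by (simp add: norm_L2_def)

lemma zero_in_L2: "(\<lambda>x. 0) \<in> L2 M" and norm_L2_zero: "norm_L2 M (\<lambda>x. 0) = 0"
  by (simp_all add: L2_def norm_L2_def)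

lemma scale_in_L2: "f \<in> L2 M \<Longrightarrow> (\<lambda>x. c * f x) \<in> L2 M"
  by (auto simp: L2_def norm_mult power_mult_distrib)

lemma norm_L2_scale: "norm_L2 M (\<lambda>x. c * f x) = cmod c * norm_L2 M f"
  by (simp add: norm_L2_def norm_mult power_mult_distrib real_sqrt_mult)

lemma norm_L2_cong_AE:
  assumes "f \<in> borel_measurable M" "g \<in> borel_measurable M" "AE x in M. f x = g x"
  shows "norm_L2 M f = norm_L2 M g"
  unfolding norm_L2_def using assms by (intro arg_cong[where f = sqrt] integral_cong_AE) auto

lemma bdd_above_opnorm_L2:
  assumes U: "bounded_operator_L2 M U"
  shows "bdd_above ((\<lambda>f. norm_L2 M (U f)) ` {f \<in> L2 M. norm_L2 M f \<le> 1})"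
proof -
  obtain K where K: "\<And>f. f \<in> L2 M \<Longrightarrow> norm_L2 M (U f) \<le> K * norm_L2 M f"
    using U unfolding bounded_operator_L2_def by blast
  show ?thesis
  proof (rule bdd_aboveI2)
    fix f assume f: "f \<in> {f \<in> L2 M. norm_L2 M f \<le> 1}"
    then have "norm_L2 M (U f) \<le> K * norm_L2 M f" using K by simp
    also have "\<dots> \<le> \<bar>K\<bar> * 1" using f norm_L2_nonneg[of M f] by (intro mult_mono) auto
    finally show "norm_L2 M (U f) \<le> \<bar>K\<bar>" by simp
  qed
qed

lemma opnorm_L2_nonneg:
  assumes U: "bounded_operator_L2 M U"
  shows "opnorm_L2 M U \<ge> 0"
proof -
  have "norm_L2 M (U (\<lambda>x. 0)) \<le> opnorm_L2 M U"
    unfolding opnorm_L2_def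
    by (intro cSUP_upper bdd_above_opnorm_L2[OF U]) (auto simp: zero_in_L2 norm_L2_zero)
  then show ?thesis using norm_L2_nonneg order_trans by blast
qed

text \<open>
  Rescaling to norm one fails for functions of norm zero, for which the bound comes from the constant
  in the definition of a bounded operator.
\<close>

lemma norm_L2_le_opnorm:
  assumes U: "bounded_operator_L2 M U" and f: "f \<in> L2 M"
  shows "norm_L2 M (U f) \<le> opnorm_L2 M U * norm_L2 M f"
proof (cases "norm_L2 M f = 0")
  case True
  moreover obtain K where "norm_L2 M (U f) \<le> K * norm_L2 M f"
    using U f unfolding bounded_operator_L2_def by blast
  ultimately show ?thesis by simp
next
  case False
  define r where "r = norm_L2 M f"
  have r: "r > 0" using False norm_L2_nonneg[of M f] by (simp add: r_def)
  let ?c = "of_real (1 / r) :: complex"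
  have g: "(\<lambda>x. ?c * f x) \<in> L2 M" using f by (rule scale_in_L2)
  have "AE x in M. U (\<lambda>x. ?c * f x) x = ?c * U f x" "U f \<in> L2 M" "U (\<lambda>x. ?c * f x) \<in> L2 M"
    using U f g unfolding bounded_operator_L2_def by blast+
  then have "norm_L2 M (U (\<lambda>x. ?c * f x)) = norm_L2 M (\<lambda>x. ?c * U f x)"
    by (intro norm_L2_cong_AE) (auto simp: L2_def)
  also have "\<dots> = norm_L2 M (U f) / r" using r by (simp only: norm_L2_scale norm_of_real) simp
  finally have "norm_L2 M (U f) / r = norm_L2 M (U (\<lambda>x. ?c * f x))" by simp
  also have "\<dots> \<le> opnorm_L2 M U"
  proof -
    have "norm_L2 M (\<lambda>x. ?c * f x) = 1" using r by (simp only: norm_L2_scale norm_of_real) (simp add: r_def)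
    with g show ?thesis
      unfolding opnorm_L2_def by (intro cSUP_upper bdd_above_opnorm_L2[OF U]) auto
  qed
  finally show ?thesis using r by (simp add: r_def field_simps)
qed

lemma opnorm_L2_le:
  assumes "\<And>f. f \<in> L2 M \<Longrightarrow> norm_L2 M (U f) \<le> B * norm_L2 M f" and B: "B \<ge> 0"
  shows "opnorm_L2 M U \<le> B"
  unfolding opnorm_L2_def
proof (rule cSUP_least)
  show "{f \<in> L2 M. norm_L2 M f \<le> 1} \<noteq> {}" using zero_in_L2[of M] norm_L2_zero[of M] by auto
next
  fix f assume f: "f \<in> {f \<in> L2 M. norm_L2 M f \<le> 1}"
  then have "norm_L2 M (U f) \<le> B * norm_L2 M f" using assms(1) by simp
  also have "\<dots> \<le> B * 1" using f B by (intro mult_left_mono) auto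
  finally show "norm_L2 M (U f) \<le> B" by simp
qed

section \<open>Infinite matrices on square-summable families\<close>

lemma L2_count_space_iff:
  "f \<in> L2 (count_space UNIV) \<longleftrightarrow> (\<lambda>k. (cmod (f k))\<^sup>2) summable_on UNIV"
proof -
  have "f \<in> L2 (count_space UNIV) \<longleftrightarrow> integrable (count_space UNIV) (\<lambda>k. (cmod (f k))\<^sup>2)"
    by (simp add: L2_def)
  also have "\<dots> \<longleftrightarrow> (\<lambda>k. norm ((cmod (f k))\<^sup>2)) summable_on UNIV"
    by (simp only: abs_summable_equivalent Infinite_Set_Sum.abs_summable_on_def)
  finally show ?thesis by simp
qed

lemma norm_L2_count_space:
  assumes "f \<in> L2 (count_space UNIV)"
  shows "(norm_L2 (count_space UNIV) f)\<^sup>2 = (\<Sum>\<^sub>\<infinity>k. (cmod (f k))\<^sup>2)"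
proof -
  have "Infinite_Set_Sum.abs_summable_on (\<lambda>k. (cmod (f k))\<^sup>2) UNIV"
    using assms by (simp add: L2_def Infinite_Set_Sum.abs_summable_on_def)
  then show ?thesis unfolding norm_L2_square infsetsum_def[symmetric] by (rule infsetsum_infsum)
qed

definition matrix_op :: "('i \<Rightarrow> 'j \<Rightarrow> complex) \<Rightarrow> ('j \<Rightarrow> complex) \<Rightarrow> 'i \<Rightarrow> complex" where
  "matrix_op K f k = (\<Sum>\<^sub>\<infinity>l. K k l * f l)"

text \<open>
  Testing the bound on the conjugate of the row itself shows that the row is square-summable. This
  makes the sum defining \<open>matrix_op\<close> converge for every square-summable \<open>f\<close>.
\<close>

lemma bounded_matrix_summable_row:
  fixes K :: "'j \<Rightarrow> complex"
  assumes K: "\<And>f L. finite L \<Longrightarrow> (cmod (\<Sum>l\<in>L. K l * f l))\<^sup>2 \<le> B\<^sup>2 * (\<Sum>l\<in>L. (cmod (f l))\<^sup>2)"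
    and f: "(\<lambda>l. (cmod (f l))\<^sup>2) summable_on UNIV"
  shows "(\<lambda>l. K l * f l) summable_on UNIV"
proof -
  have "(\<lambda>l. (cmod (K l))\<^sup>2) summable_on UNIV"
  proof (rule nonneg_bdd_above_summable_on)
    show "bdd_above (sum (\<lambda>l. (cmod (K l))\<^sup>2) ` {L. L \<subseteq> UNIV \<and> finite L})"
    proof (rule bdd_aboveI2)
      fix L :: "'j set" assume "L \<in> {L. L \<subseteq> UNIV \<and> finite L}"
      then have L: "finite L" by simp
      define S where "S = (\<Sum>l\<in>L. (cmod (K l))\<^sup>2)"
      have S: "S \<ge> 0" by (simp add: S_def sum_nonneg)
      have KK: "(\<Sum>l\<in>L. K l * cnj (K l)) = of_real S"
        by (simp add: S_def flip: complex_norm_square)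
      have "S\<^sup>2 \<le> B\<^sup>2 * S"
        using K[OF L, of "\<lambda>l. cnj (K l)"] unfolding KK complex_mod_cnj S_def[symmetric] by simp
      then show "(\<Sum>l\<in>L. (cmod (K l))\<^sup>2) \<le> B\<^sup>2"
        unfolding S_def[symmetric] using S by (cases "S = 0") (auto simp: power2_eq_square)
    qed
  qed simp
  then have "(\<lambda>l. (cmod (K l))\<^sup>2 + (cmod (f l))\<^sup>2) summable_on UNIV"
    using f by (rule summable_on_add)
  then have "(\<lambda>l. norm (K l * f l)) summable_on UNIV"
  proof (rule Infinite_Sum.abs_summable_on_comparison_test')
    fix l
    have "cmod (K l) * cmod (f l) \<le> (cmod (K l))\<^sup>2 + (cmod (f l))\<^sup>2"
      using sum_squares_bound[of "cmod (K l)" "cmod (f l)"]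
        mult_nonneg_nonneg[OF norm_ge_zero[of "K l"] norm_ge_zero[of "f l"]] by linarith
    then show "norm (K l * f l) \<le> (cmod (K l))\<^sup>2 + (cmod (f l))\<^sup>2" by (simp add: norm_mult)
  qed
  then show ?thesis by (rule abs_summable_summable)
qed

text \<open>
  Both index sets are finite in the hypothesis. The columns are passed to the limit first, with the
  finite set of rows fixed, and then the supremum over the rows is taken.
\<close>

theorem matrix_op_bounded:
  fixes K :: "'i \<Rightarrow> 'i \<Rightarrow> complex"
  assumes B: "B \<ge> 0"
    and K: "\<And>F L f. finite F \<Longrightarrow> finite L \<Longrightarrow>
       (\<Sum>k\<in>F. (cmod (\<Sum>l\<in>L. K k l * f l))\<^sup>2) \<le> B\<^sup>2 * (\<Sum>l\<in>L. (cmod (f l))\<^sup>2)"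
  shows "bounded_operator_L2 (count_space UNIV) (matrix_op K)"
    and "opnorm_L2 (count_space UNIV) (matrix_op K) \<le> B"
proof -
  let ?M = "count_space UNIV :: 'i measure"
  have row: "(\<lambda>l. K k l * f l) summable_on UNIV" if "f \<in> L2 ?M" for f k
    by (rule bounded_matrix_summable_row[where B = B])
       (use K[of "{k}"] that in \<open>auto simp: L2_count_space_iff\<close>)
  have fin: "(\<Sum>k\<in>F. (cmod (matrix_op K f k))\<^sup>2) \<le> B\<^sup>2 * (\<Sum>\<^sub>\<infinity>l. (cmod (f l))\<^sup>2)"
    if f: "f \<in> L2 ?M" and F: "finite F" for f F
  proof (rule tendsto_upperbound)
    show "((\<lambda>L. \<Sum>k\<in>F. (cmod (\<Sum>l\<in>L. K k l * f l))\<^sup>2) \<longlongrightarrow> (\<Sum>k\<in>F. (cmod (matrix_op K f k))\<^sup>2)) (finite_subsets_at_top UNIV)"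
      unfolding matrix_op_def by (intro tendsto_intros infsum_tendsto row f)
    have "(\<Sum>k\<in>F. (cmod (\<Sum>l\<in>L. K k l * f l))\<^sup>2) \<le> B\<^sup>2 * (\<Sum>\<^sub>\<infinity>l. (cmod (f l))\<^sup>2)" if L: "finite L" for L
    proof -
      have "(\<Sum>l\<in>L. (cmod (f l))\<^sup>2) \<le> (\<Sum>\<^sub>\<infinity>l. (cmod (f l))\<^sup>2)"
        using f L by (intro finite_sum_le_infsum) (auto simp: L2_count_space_iff)
      then have "B\<^sup>2 * (\<Sum>l\<in>L. (cmod (f l))\<^sup>2) \<le> B\<^sup>2 * (\<Sum>\<^sub>\<infinity>l. (cmod (f l))\<^sup>2)"
        by (intro mult_left_mono) auto
      with K[OF F L, of f] show ?thesis by linarith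
    qed
    then show "\<forall>\<^sub>F L in finite_subsets_at_top UNIV.
        (\<Sum>k\<in>F. (cmod (\<Sum>l\<in>L. K k l * f l))\<^sup>2) \<le> B\<^sup>2 * (\<Sum>\<^sub>\<infinity>l. (cmod (f l))\<^sup>2)"
      by (intro eventually_finite_subsets_at_top_weakI) auto
  qed simp
  have mem: "matrix_op K f \<in> L2 ?M" if f: "f \<in> L2 ?M" for f
    unfolding L2_count_space_iff
    by (rule nonneg_bdd_above_summable_on)
       (auto intro!: bdd_aboveI2[where M = "B\<^sup>2 * (\<Sum>\<^sub>\<infinity>l. (cmod (f l))\<^sup>2)"] fin f)
  have norm: "norm_L2 ?M (matrix_op K f) \<le> B * norm_L2 ?M f" if f: "f \<in> L2 ?M" for f
  proof (rule power2_le_imp_le)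
    have "(\<Sum>\<^sub>\<infinity>k. (cmod (matrix_op K f k))\<^sup>2) \<le> B\<^sup>2 * (\<Sum>\<^sub>\<infinity>l. (cmod (f l))\<^sup>2)"
      using mem[OF f] fin[OF f] by (intro infsum_le_finite_sums) (auto simp: L2_count_space_iff)
    then show "(norm_L2 ?M (matrix_op K f))\<^sup>2 \<le> (B * norm_L2 ?M f)\<^sup>2"
      by (simp add: power_mult_distrib norm_L2_count_space f mem)
  qed (intro mult_nonneg_nonneg B norm_L2_nonneg)
  have add: "matrix_op K (\<lambda>y. f y + g y) x = matrix_op K f x + matrix_op K g x"
    if "f \<in> L2 ?M" "g \<in> L2 ?M" for f g x
    unfolding matrix_op_def by (simp add: ring_distribs infsum_add row that)
  have scale: "matrix_op K (\<lambda>y. c * f y) x = c * matrix_op K f x" for c f x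
    unfolding matrix_op_def infsum_cmult_right'[symmetric] by (simp add: ac_simps)
  have ext: "matrix_op K f x = matrix_op K g x" if "\<forall>x. f x = g x" for f g x
    using that by (simp add: matrix_op_def)
  show "bounded_operator_L2 ?M (matrix_op K)"
    unfolding bounded_operator_L2_def AE_count_space
    using mem norm add scale ext by blast
  show "opnorm_L2 ?M (matrix_op K) \<le> B"
    by (rule opnorm_L2_le[OF norm B])
qed

section \<open>Rapidly decreasing functions on the lattice\<close>

lemma summable_on_inverse_square_int: "(\<lambda>z::int. 1 / (1 + \<bar>real_of_int z\<bar>)\<^sup>2) summable_on UNIV"
proof -
  let ?g = "\<lambda>z::int. 1 / (1 + \<bar>real_of_int z\<bar>)\<^sup>2"
  have "summable (\<lambda>n. 1 / (1 + real n)\<^sup>2)"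
    using inverse_power_summable[of 2, where 'a=real] summable_Suc_iff[of "\<lambda>n. inverse (real n ^ 2)"]
    by (simp add: inverse_eq_divide)
  then have nat: "(\<lambda>n::nat. 1 / (1 + real n)\<^sup>2) summable_on UNIV"
    by (intro norm_summable_imp_summable_on) simp
  have "?g summable_on range int" "?g summable_on range (\<lambda>n. - int n)"
    using nat by (simp_all add: summable_on_reindex inj_on_def o_def)
  then have "?g summable_on (range int \<union> range (\<lambda>n. - int n))" by (rule summable_on_union)
  also have "range int \<union> range (\<lambda>n. - int n) = UNIV"
  proof -
    have "z \<in> range int \<union> range (\<lambda>n. - int n)" for z by (cases z rule: int_cases2) auto
    then show ?thesis by blast
  qed
  finally show ?thesis .
qed

text \<open>
  A product of summable functions of the single coordinates is summable over the lattice.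
\<close>

lemma summable_on_lattice_weight:
  "(\<lambda>k::int^'n. \<Prod>j\<in>UNIV. 1 / (1 + \<bar>real_of_int (k $ j)\<bar>)\<^sup>2) summable_on UNIV"
proof -
  have "Infinite_Set_Sum.abs_summable_on (\<lambda>g. \<Prod>j\<in>(UNIV::'n set). 1 / (1 + \<bar>real_of_int (g j)\<bar>)\<^sup>2) (Pi\<^sub>E UNIV (\<lambda>_. UNIV))"
    using summable_on_inverse_square_int
    by (intro Infinite_Set_Sum.abs_summable_on_prod_PiE) (auto simp flip: abs_summable_equivalent)
  then have "(\<lambda>g::'n \<Rightarrow> int. \<Prod>j\<in>UNIV. 1 / (1 + \<bar>real_of_int (g j)\<bar>)\<^sup>2) summable_on UNIV"
    by (auto simp: PiE_UNIV_domain simp flip: abs_summable_equivalent intro: abs_summable_summable)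
  moreover have "bij_betw vec_nth (UNIV :: (int^'n) set) UNIV"
    by (rule bij_betwI[where g = vec_lambda]) auto
  ultimately show ?thesis
    using summable_on_reindex_bij_betw[of vec_nth "UNIV :: (int^'n) set" UNIV
       "\<lambda>g::'n \<Rightarrow> int. \<Prod>j\<in>UNIV. 1 / (1 + \<bar>real_of_int (g j)\<bar>)\<^sup>2"] by simp
qed

text \<open>
  The exponent \<open>2 * CARD('n)\<close> spends two powers of \<open>1 + norm\<close> on each coordinate.
\<close>

lemma discrete_schwartz_abs_summable:
  fixes f :: "int^'n \<Rightarrow> complex"
  assumes "f \<in> discrete_schwartz"
  shows "(\<lambda>k. cmod (f k)) summable_on UNIV"
proof -
  obtain C where C: "\<And>k. (1 + norm (vec_of_int k)) ^ (2 * CARD('n)) * cmod (f k) \<le> C"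
    using assms unfolding discrete_schwartz_def by blast
  have "cmod (f k) \<le> C * (\<Prod>j\<in>UNIV. 1 / (1 + \<bar>real_of_int (k $ j)\<bar>)\<^sup>2)" for k
  proof -
    have pos: "(\<Prod>j\<in>UNIV. (1 + \<bar>real_of_int (k $ j)\<bar>)\<^sup>2) > 0" by (intro prod_pos) (auto simp: add_pos_nonneg)
    have "(\<Prod>j\<in>UNIV. (1 + \<bar>real_of_int (k $ j)\<bar>)\<^sup>2) \<le> (\<Prod>j\<in>(UNIV::'n set). (1 + norm (vec_of_int k))\<^sup>2)"
    proof (intro prod_mono conjI power_mono)
      fix j show "1 + \<bar>real_of_int (k $ j)\<bar> \<le> 1 + norm (vec_of_int k)"
        using component_le_norm_cart[of "vec_of_int k" j] by (simp add: vec_of_int_def)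
    qed auto
    also have "\<dots> = (1 + norm (vec_of_int k)) ^ (2 * CARD('n))" by (simp add: power_mult)
    finally have "(\<Prod>j\<in>UNIV. (1 + \<bar>real_of_int (k $ j)\<bar>)\<^sup>2) * cmod (f k) \<le> C"
      using C[of k] mult_right_mono[of _ _ "cmod (f k)"] norm_ge_zero order_trans by blast
    then show ?thesis using pos by (simp add: prod_dividef field_simps)
  qed
  then show ?thesis
    by (intro Infinite_Sum.abs_summable_on_comparison_test'[OF summable_on_cmult_right[OF summable_on_lattice_weight]])
qed

lemma infinite_UNIV_int_vec: "infinite (UNIV :: (int^'n) set)"
proof -
  have "inj (\<lambda>z::int. (\<chi> j. z) :: int^'n)" by (auto simp: inj_on_def vec_eq_iff)
  then have "infinite (range (\<lambda>z::int. (\<chi> j. z) :: int^'n))" by (simp add: finite_image_iff)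
  then show ?thesis by (rule infinite_super[OF subset_UNIV])
qed

section \<open>Duality with the discrete operator\<close>

text \<open>
  A Cauchy-Schwarz argument in additive form, where \<open>Y\<close> also occurs on the right. The optimal scale is
  \<open>s = R\<^sup>2\<close>; for \<open>R = 0\<close> a small \<open>s\<close> forces \<open>Y = 0\<close>.
\<close>

lemma quadratic_bound_from_scaled:
  fixes Y A R :: real
  assumes h: "\<And>s. s > 0 \<Longrightarrow> 2 * Y \<le> s * A + R\<^sup>2 * Y / s" and A: "A \<ge> 0" and Y: "Y \<ge> 0"
  shows "Y \<le> R\<^sup>2 * A"
proof (cases "R = 0")
  case False
  then show ?thesis using h[of "R\<^sup>2"] by simp
next
  case True
  show ?thesis
  proof (cases "Y = 0")
    case False
    then have "2 * Y \<le> Y / (A + 1) * A" using h[of "Y / (A + 1)"] A Y True by simp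
    also have "\<dots> \<le> Y" using A Y by (simp add: field_simps)
    finally show ?thesis using Y False by simp
  qed (use True in simp)
qed

context periodic_symbol
begin

definition dual_symbol :: "int^'n \<Rightarrow> real^'n \<Rightarrow> complex" where
  "dual_symbol k \<xi> = cnj (a \<xi> (vec_of_int (- k)))"

text \<open>
  The matrix of the discrete operator with symbol \<open>dual_symbol\<close> with respect to the standard basis.
\<close>

definition dual_matrix :: "int^'n \<Rightarrow> int^'n \<Rightarrow> complex" where
  "dual_matrix k l = (LINT \<xi>:cbox 0 1|lborel.
     wave (vec_of_int k) \<xi> * dual_symbol k \<xi> * wave (- vec_of_int l) \<xi>)"

lemma continuous_on_dual_symbol [continuous_intros]: "continuous_on S (dual_symbol k)"
  unfolding dual_symbol_def[abs_def] by (intro continuous_intros)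

lemma measurable_dual_symbol [measurable]: "dual_symbol k \<in> borel_measurable borel"
  by (intro borel_measurable_continuous_onI continuous_intros)

lemma dual_matrix_sum:
  assumes L: "finite L"
  shows "(\<Sum>l\<in>L. dual_matrix k l * f l) = (LINT \<xi>:cbox 0 1|lborel.
     wave (vec_of_int k) \<xi> * dual_symbol k \<xi> * (\<Sum>l\<in>L. wave (- vec_of_int l) \<xi> * f l))"
proof -
  have "(LINT \<xi>:cbox 0 1|lborel. wave (vec_of_int k) \<xi> * dual_symbol k \<xi> * (\<Sum>l\<in>L. wave (- vec_of_int l) \<xi> * f l)) =
     (LINT \<xi>:cbox 0 1|lborel. (\<Sum>l\<in>L. wave (vec_of_int k) \<xi> * dual_symbol k \<xi> * wave (- vec_of_int l) \<xi> * f l))"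
    by (simp add: sum_distrib_left mult.assoc)
  also have "\<dots> = (\<Sum>l\<in>L. LINT \<xi>:cbox 0 1|lborel. wave (vec_of_int k) \<xi> * dual_symbol k \<xi> * wave (- vec_of_int l) \<xi> * f l)"
    by (rule set_integral_sum) (intro set_integrable_unit_cube continuous_intros)
  finally show ?thesis by (simp add: dual_matrix_def)
qed

text \<open>
  Duality. Pairing the values \<open>y\<close> of the matrix on \<open>f\<close> with \<open>y\<close> itself gives an integral over the cube of the
  trigonometric polynomial \<open>H\<close> with coefficients \<open>f\<close> against \<open>torus_op\<close> applied to the one with
  coefficients \<open>y\<close>. The frequencies of the latter are negated, as the symbol is evaluated at \<open>- k\<close>.
\<close>

lemma dual_matrix_bound:
  assumes R: "\<And>F c. finite F \<Longrightarrow>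
      (LINT x:cbox 0 1|lborel. (cmod (torus_op F c x))\<^sup>2) \<le> R\<^sup>2 * (\<Sum>k\<in>F. (cmod (c k))\<^sup>2)"
    and F: "finite F" and L: "finite L"
  shows "(\<Sum>k\<in>F. (cmod (\<Sum>l\<in>L. dual_matrix k l * f l))\<^sup>2) \<le> R\<^sup>2 * (\<Sum>l\<in>L. (cmod (f l))\<^sup>2)"
proof -
  define H where "H \<xi> = (\<Sum>l\<in>L. wave (- vec_of_int l) \<xi> * f l)" for \<xi>
  define y where "y k = (\<Sum>l\<in>L. dual_matrix k l * f l)" for k
  define G where "G = torus_op (uminus ` F) (\<lambda>k. y (- k))"
  define Y where "Y = (\<Sum>k\<in>F. (cmod (y k))\<^sup>2)"
  have contH: "continuous_on S H" for S
    unfolding H_def[abs_def] by (intro continuous_intros)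
  have contG: "continuous_on S G" for S
    unfolding G_def by (intro continuous_intros)
  have G: "G \<xi> = (\<Sum>k\<in>F. y k * wave (- vec_of_int k) \<xi> * a \<xi> (vec_of_int (- k)))" for \<xi>
    unfolding G_def torus_op_def by (subst sum.reindex) (auto simp: inj_on_def vec_of_int_minus)
  have y: "y k = (LINT \<xi>:cbox 0 1|lborel. wave (vec_of_int k) \<xi> * dual_symbol k \<xi> * H \<xi>)" for k
    unfolding y_def H_def by (rule dual_matrix_sum[OF L])
  have Gbound: "(LINT \<xi>:cbox 0 1|lborel. (cmod (G \<xi>))\<^sup>2) \<le> R\<^sup>2 * Y"
    using R[of "uminus ` F" "\<lambda>k. y (- k)"] F
    by (simp add: G_def Y_def sum.reindex inj_on_def)
  have Heq: "(LINT \<xi>:cbox 0 1|lborel. (cmod (H \<xi>))\<^sup>2) = (\<Sum>l\<in>L. (cmod (f l))\<^sup>2)"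
    unfolding H_def by (rule cube_integral_trig_polynomial_square[OF L])
  have "of_real Y = (\<Sum>k\<in>F. cnj (y k) * y k)"
    unfolding Y_def by (simp add: mult.commute flip: complex_norm_square)
  also have "\<dots> = (\<Sum>k\<in>F. LINT \<xi>:cbox 0 1|lborel. cnj (y k) * (wave (vec_of_int k) \<xi> * dual_symbol k \<xi> * H \<xi>))"
    by (simp add: y[symmetric])
  also have "\<dots> = (LINT \<xi>:cbox 0 1|lborel. (\<Sum>k\<in>F. cnj (y k) * (wave (vec_of_int k) \<xi> * dual_symbol k \<xi> * H \<xi>)))"
    by (rule set_integral_sum[symmetric]) (intro set_integrable_unit_cube continuous_intros contH)
  also have "(\<lambda>\<xi>. \<Sum>k\<in>F. cnj (y k) * (wave (vec_of_int k) \<xi> * dual_symbol k \<xi> * H \<xi>)) = (\<lambda>\<xi>. cnj (G \<xi>) * H \<xi>)"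
    unfolding G cnj_sum sum_distrib_right
    by (intro ext sum.cong refl) (simp add: dual_symbol_def cnj_wave ac_simps)
  finally have Yint: "of_real Y = (LINT \<xi>:cbox 0 1|lborel. cnj (G \<xi>) * H \<xi>)" .
  have "Y \<le> R\<^sup>2 * (\<Sum>l\<in>L. (cmod (f l))\<^sup>2)"
  proof (rule quadratic_bound_from_scaled)
    fix s :: real assume s: "s > 0"
    have "Y \<le> cmod (of_real Y)" by simp
    also have "\<dots> \<le> (LINT \<xi>:cbox 0 1|lborel. cmod (cnj (G \<xi>) * H \<xi>))"
      unfolding Yint by (rule set_integral_norm_bound) (intro set_integrable_unit_cube continuous_intros contH contG)
    finally have "2 * Y \<le> 2 * (LINT \<xi>:cbox 0 1|lborel. cmod (cnj (G \<xi>) * H \<xi>))" by simp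
    also have "\<dots> = (LINT \<xi>:cbox 0 1|lborel. 2 * cmod (cnj (G \<xi>) * H \<xi>))" by simp
    also have "\<dots> \<le> (LINT \<xi>:cbox 0 1|lborel. s * (cmod (H \<xi>))\<^sup>2 + (cmod (G \<xi>))\<^sup>2 / s)"
    proof (rule set_integral_mono)
      fix \<xi>
      \<comment> \<open>The inequality of the means with weight \<open>s\<close>, from a nonnegative square.\<close>
      have "0 \<le> (s * cmod (H \<xi>) - cmod (G \<xi>))\<^sup>2 / s" using s by simp
      also have "\<dots> = s * (cmod (H \<xi>))\<^sup>2 + (cmod (G \<xi>))\<^sup>2 / s - 2 * (cmod (G \<xi>) * cmod (H \<xi>))"
        using s by (simp add: power2_eq_square field_simps)
      finally show "2 * cmod (cnj (G \<xi>) * H \<xi>) \<le> s * (cmod (H \<xi>))\<^sup>2 + (cmod (G \<xi>))\<^sup>2 / s"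
        by (simp add: norm_mult)
    qed (use s in \<open>intro set_integrable_unit_cube continuous_intros contH contG; simp\<close>)+
    also have "\<dots> = s * (LINT \<xi>:cbox 0 1|lborel. (cmod (H \<xi>))\<^sup>2) + (LINT \<xi>:cbox 0 1|lborel. (cmod (G \<xi>))\<^sup>2) / s"
    proof (subst set_integral_add)
      show "set_integrable lborel (cbox 0 1) (\<lambda>\<xi>. s * (cmod (H \<xi>))\<^sup>2)"
        by (intro set_integrable_unit_cube continuous_intros contH)
      show "set_integrable lborel (cbox 0 1) (\<lambda>\<xi>. (cmod (G \<xi>))\<^sup>2 / s)"
        using s by (intro set_integrable_unit_cube continuous_intros contG) simp
    qed simp
    also have "\<dots> \<le> s * (\<Sum>l\<in>L. (cmod (f l))\<^sup>2) + R\<^sup>2 * Y / s"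
      unfolding Heq using Gbound s by (intro add_left_mono divide_right_mono) auto
    finally show "2 * Y \<le> s * (\<Sum>l\<in>L. (cmod (f l))\<^sup>2) + R\<^sup>2 * Y / s" .
  qed (auto simp: Y_def intro!: sum_nonneg)
  then show ?thesis unfolding Y_def y_def .
qed

text \<open>
  Rapid decrease makes \<open>f\<close> absolutely summable, so the sum in \<open>discrete_fourier\<close> can be interchanged
  with the integral over the cube. The lattice is enumerated in order to use the
  theorem for series of functions, which also gives measurability of the sum.
\<close>

lemma discrete_pseudo_diff_op_eq_matrix_op:
  assumes f: "f \<in> discrete_schwartz"
  shows "discrete_pseudo_diff_op dual_symbol f k = matrix_op dual_matrix f k"
proof -
  \<comment> \<open>\<open>from_nat_into\<close> is a bijection because the lattice is countable and infinite.\<close>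
  define e :: "nat \<Rightarrow> int^'n" where "e = from_nat_into UNIV"
  have e: "bij_betw e UNIV UNIV"
    unfolding e_def by (rule bij_betw_from_nat_into) (auto simp: infinite_UNIV_int_vec)
  have "(\<lambda>n. cmod (f (e n))) summable_on UNIV"
    using discrete_schwartz_abs_summable[OF f] summable_on_reindex_bij_betw[OF e, of "\<lambda>l. cmod (f l)"] by simp
  then have sf: "summable (\<lambda>n. cmod (f (e n)))" by (rule summable_on_imp_summable)
  have infsum_suminf: "(\<Sum>\<^sub>\<infinity>l. g l * f l) = (\<Sum>n. g (e n) * f (e n))"
    if g: "\<And>l. cmod (g l) \<le> D" for g :: "int^'n \<Rightarrow> complex" and D
  proof -
    have "summable (\<lambda>n. D * cmod (f (e n)))" by (rule summable_mult[OF sf])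
    then have sn: "summable (\<lambda>n. norm (g (e n) * f (e n)))"
      by (rule summable_comparison_test'[where N = 0]) (auto simp: norm_mult intro!: mult_right_mono g)
    have "((\<lambda>n. g (e n) * f (e n)) has_sum (\<Sum>n. g (e n) * f (e n))) UNIV"
      by (rule norm_summable_imp_has_sum[OF sn summable_sums[OF summable_norm_cancel[OF sn]]])
    then have "(\<Sum>n. g (e n) * f (e n)) = (\<Sum>\<^sub>\<infinity>n. g (e n) * f (e n))" by (simp add: infsumI)
    also have "\<dots> = (\<Sum>\<^sub>\<infinity>l. g l * f l)" by (rule infsum_reindex_bij_betw[OF e])
    finally show ?thesis by simp
  qed
  let ?u = "\<lambda>\<xi>. wave (vec_of_int k) \<xi> * dual_symbol k \<xi>"
  let ?g = "\<lambda>n \<xi>. indicator (cbox 0 1) \<xi> *\<^sub>R (?u \<xi> * wave (- vec_of_int (e n)) \<xi> * f (e n))"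
  have int: "integrable lborel (?g n)" for n
    unfolding set_integrable_def[symmetric] by (intro set_integrable_unit_cube continuous_intros)
  have nb: "norm (?g n \<xi>) \<le> indicator (cbox 0 1) \<xi> *\<^sub>R (A * cmod (f (e n)))" for n \<xi>
    using bound by (auto simp: norm_mult dual_symbol_def intro!: mult_right_mono split: split_indicator)
  have ii: "integrable lborel (\<lambda>\<xi>. indicator (cbox 0 (1::real^'n)) \<xi> *\<^sub>R (A * cmod (f (e n))))" for n
    unfolding set_integrable_def[symmetric] by (intro set_integrable_unit_cube continuous_intros)
  have K: "cmod (dual_matrix k l) \<le> A" for l
  proof -
    have "cmod (dual_matrix k l) \<le> (LINT \<xi>:cbox 0 1|lborel. cmod (?u \<xi> * wave (- vec_of_int l) \<xi>))"
      unfolding dual_matrix_def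
      by (rule set_integral_norm_bound) (intro set_integrable_unit_cube continuous_intros)
    also have "\<dots> \<le> (LINT \<xi>:cbox 0 (1::real^'n)|lborel. A)"
      using bound
      by (intro set_integral_mono set_integrable_unit_cube continuous_intros) (auto simp: norm_mult dual_symbol_def)
    also have "\<dots> = A"
      by (simp add: set_lebesgue_integral_def measure_unit_cube)
    finally show ?thesis .
  qed
  have "discrete_pseudo_diff_op dual_symbol f k = (\<integral>\<xi>. (\<Sum>n. ?g n \<xi>) \<partial>lborel)"
    unfolding discrete_pseudo_diff_op_def set_lebesgue_integral_def
  proof (intro Bochner_Integration.integral_cong refl)
    fix \<xi> :: "real^'n"
    have s: "summable (\<lambda>n. wave (- vec_of_int (e n)) \<xi> * f (e n))"
      by (rule summable_norm_cancel) (simp add: norm_mult sf)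
    have df: "discrete_fourier f \<xi> = (\<Sum>n. wave (- vec_of_int (e n)) \<xi> * f (e n))"
      unfolding discrete_fourier_def exp_minus_eq_wave by (rule infsum_suminf[where D = 1]) simp
    have "(\<Sum>n. ?g n \<xi>) = (\<Sum>n. (indicator (cbox 0 1) \<xi> *\<^sub>R ?u \<xi>) * (wave (- vec_of_int (e n)) \<xi> * f (e n)))"
      by (simp add: mult.assoc)
    also have "\<dots> = (indicator (cbox 0 1) \<xi> *\<^sub>R ?u \<xi>) * discrete_fourier f \<xi>"
      unfolding df by (rule suminf_mult[OF s])
    finally show "indicator (cbox 0 1) \<xi> *\<^sub>R
         (exp (\<i> * of_real (2 * pi * (vec_of_int k \<bullet> \<xi>))) * dual_symbol k \<xi> * discrete_fourier f \<xi>) = (\<Sum>n. ?g n \<xi>)"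
      by (simp add: wave_def)
  qed
  also have "\<dots> = (\<Sum>n. \<integral>\<xi>. ?g n \<xi> \<partial>lborel)"
  proof (rule integral_suminf[OF int])
    show "AE \<xi> in lborel. summable (\<lambda>n. norm (?g n \<xi>))"
    proof (rule AE_I2)
      fix \<xi> :: "real^'n"
      show "summable (\<lambda>n. norm (?g n \<xi>))"
        by (rule summable_comparison_test'[where N = 0, OF summable_scaleR_right[OF summable_mult[OF sf]]])
           (use nb in auto)
    qed
    have "norm (\<integral>\<xi>. norm (?g n \<xi>) \<partial>lborel) \<le> A * cmod (f (e n))" for n
    proof -
      have "norm (\<integral>\<xi>. norm (?g n \<xi>) \<partial>lborel) = (\<integral>\<xi>. norm (?g n \<xi>) \<partial>lborel)" by simp
      also have "\<dots> \<le> (\<integral>\<xi>. indicator (cbox 0 (1::real^'n)) \<xi> *\<^sub>R (A * cmod (f (e n))) \<partial>lborel)"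
        by (intro integral_mono integrable_norm int ii nb)
      also have "\<dots> = A * cmod (f (e n))"
        by (simp add: measure_unit_cube)
      finally show ?thesis .
    qed
    then show "summable (\<lambda>n. \<integral>\<xi>. norm (?g n \<xi>) \<partial>lborel)"
      by (intro summable_comparison_test'[where N = 0, OF summable_mult[OF sf, of A]])
  qed
  also have "\<dots> = (\<Sum>n. dual_matrix k (e n) * f (e n))"
  proof -
    have "(\<integral>\<xi>. ?g n \<xi> \<partial>lborel) = dual_matrix k (e n) * f (e n)" for n
      unfolding dual_matrix_def set_lebesgue_integral_def by (simp flip: mult_scaleR_left)
    then show ?thesis by simp
  qed
  also have "\<dots> = matrix_op dual_matrix f k"
    unfolding matrix_op_def by (rule infsum_suminf[symmetric]) (rule K)
  finally show ?thesis .
qed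

text \<open>
  The operator \<open>T\<close> enters only through its bound on packets, where it agrees almost everywhere with
  \<open>pseudo_diff_op a\<close>.
\<close>

theorem dual_operator_bounded:
  assumes T: "is_bounded_extension lborel schwartz (pseudo_diff_op a) T"
  shows "is_bounded_extension (count_space UNIV) discrete_schwartz
            (discrete_pseudo_diff_op dual_symbol) (matrix_op dual_matrix)"
    and "opnorm_L2 (count_space UNIV) (matrix_op dual_matrix)
           \<le> sqrt (2 * exp (2 * pi * CARD('n)) / sqrt 2 ^ CARD('n)) * opnorm_L2 lborel T"
proof -
  let ?D = "2 * exp (2 * pi * CARD('n)) / sqrt 2 ^ CARD('n)"
  define B where "B = opnorm_L2 lborel T"
  have bT: "bounded_operator_L2 lborel T"
    and eT: "\<And>f. f \<in> schwartz \<Longrightarrow> AE x in lborel. T f x = pseudo_diff_op a f x"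
    using T by (auto simp: is_bounded_extension_def)
  have B: "B \<ge> 0" unfolding B_def by (rule opnorm_L2_nonneg[OF bT])
  have packet: "integrable lborel (\<lambda>x. (cmod (pseudo_diff_op a (packet F c M) x))\<^sup>2) \<and>
      (\<integral>x. (cmod (pseudo_diff_op a (packet F c M) x))\<^sup>2 \<partial>lborel) \<le> B\<^sup>2 * (\<integral>x. (cmod (packet F c M x))\<^sup>2 \<partial>lborel)"
    if F: "finite F" and M: "M > 0" for F c M
  proof -
    let ?f = "packet F c M"
    have f: "?f \<in> L2 lborel"
      using has_bochner_integral_packet_square[OF F M, of c] by (auto simp: L2_def has_bochner_integral_iff)
    have Tf: "T ?f \<in> L2 lborel" using bT f by (simp add: bounded_operator_L2_def)
    have ae: "AE x in lborel. T ?f x = pseudo_diff_op a ?f x"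
      by (rule eT) (rule packet_in_schwartz[OF F M])
    note [measurable] = measurable_pseudo_diff_op_packet[OF F M]
    have [measurable]: "T ?f \<in> borel_measurable borel" using Tf by (simp add: L2_def)
    have "integrable lborel (\<lambda>x. (cmod (T ?f x))\<^sup>2)" using Tf by (simp add: L2_def)
    then have 1: "integrable lborel (\<lambda>x. (cmod (pseudo_diff_op a ?f x))\<^sup>2)"
      by (rule integrable_cong_AE[THEN iffD1, rotated 3]) (use ae in auto)
    have "norm_L2 lborel (pseudo_diff_op a ?f) = norm_L2 lborel (T ?f)"
      by (rule norm_L2_cong_AE) (use ae in auto)
    also have "\<dots> \<le> B * norm_L2 lborel ?f"
      unfolding B_def by (rule norm_L2_le_opnorm[OF bT f])
    finally have "(norm_L2 lborel (pseudo_diff_op a ?f))\<^sup>2 \<le> (B * norm_L2 lborel ?f)\<^sup>2"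
      by (intro power_mono norm_L2_nonneg)
    with 1 show ?thesis by (simp add: power_mult_distrib norm_L2_square)
  qed
  have "(LINT x:cbox 0 1|lborel. (cmod (torus_op F c x))\<^sup>2) \<le> (sqrt ?D * B)\<^sup>2 * (\<Sum>k\<in>F. (cmod (c k))\<^sup>2)"
    if "finite F" for F c
    using torus_transference[OF that, of c B] packet[OF that] by (simp add: power_mult_distrib)
  note mat = dual_matrix_bound[OF this]
  have nn: "sqrt ?D * B \<ge> 0" using B by simp
  show "is_bounded_extension (count_space UNIV) discrete_schwartz
            (discrete_pseudo_diff_op dual_symbol) (matrix_op dual_matrix)"
    unfolding is_bounded_extension_def AE_count_space
    using matrix_op_bounded(1)[OF nn mat] discrete_pseudo_diff_op_eq_matrix_op by simp
  show "opnorm_L2 (count_space UNIV) (matrix_op dual_matrix) \<le> sqrt ?D * opnorm_L2 lborel T"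
    using matrix_op_bounded(2)[OF nn mat] unfolding B_def .
qed

end

theorem theorem5:
  "\<exists>C::real. \<forall>a :: real^'n \<Rightarrow> real^'n \<Rightarrow> complex.
     periodic_in_fst a \<and>
     continuous_on UNIV (\<lambda>(x, \<xi>). a x \<xi>) \<and>
     bounded (range (\<lambda>(x, \<xi>). a x \<xi>)) \<longrightarrow>
     (\<forall>T. is_bounded_extension lborel schwartz (pseudo_diff_op a) T \<longrightarrow>
       (\<exists>t. is_bounded_extension (count_space UNIV) discrete_schwartz
              (discrete_pseudo_diff_op (\<lambda>k \<xi>. cnj (a \<xi> (vec_of_int (- k))))) t \<and>
            opnorm_L2 (count_space UNIV) t \<le> C * opnorm_L2 lborel T))"
proof (intro exI[of _ "sqrt (2 * exp (2 * pi * CARD('n)) / sqrt 2 ^ CARD('n))"] allI impI)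
  fix a :: "real^'n \<Rightarrow> real^'n \<Rightarrow> complex" and T
  assume a: "periodic_in_fst a \<and> continuous_on UNIV (\<lambda>(x, \<xi>). a x \<xi>) \<and> bounded (range (\<lambda>(x, \<xi>). a x \<xi>))"
    and T: "is_bounded_extension lborel schwartz (pseudo_diff_op a) T"
  obtain A where "\<forall>z\<in>range (\<lambda>(x, \<xi>). a x \<xi>). cmod z \<le> A"
    using a unfolding bounded_iff by blast
  then have "cmod (a x \<xi>) \<le> A" for x \<xi>
    using rangeI[of "\<lambda>(x, \<xi>). a x \<xi>" "(x, \<xi>)"] by simp
  with a interpret periodic_symbol a A by unfold_locales auto
  have m: "(\<lambda>k \<xi>. cnj (a \<xi> (vec_of_int (- k)))) = dual_symbol"
    by (simp add: dual_symbol_def fun_eq_iff)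
  show "\<exists>t. is_bounded_extension (count_space UNIV) discrete_schwartz
              (discrete_pseudo_diff_op (\<lambda>k \<xi>. cnj (a \<xi> (vec_of_int (- k))))) t \<and>
            opnorm_L2 (count_space UNIV) t
              \<le> sqrt (2 * exp (2 * pi * CARD('n)) / sqrt 2 ^ CARD('n)) * opnorm_L2 lborel T"
    unfolding m using dual_operator_bounded[OF T] by blast
qed

end
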